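(* Let $T=(V,E)$ be a tree with $|V|=p\ge 2$, let $\mathbf{a}=(a_i,\,i\in V)\in(0,\infty)^p$ and $\mathbf{C}=[c_{i,j}]_{i,j\in V}\in C_T$, and let $\mathbf{S}=(S_i,\,i\in V)$ be a random vector following the tree-Kummer distribution $\mathrm{TK}(\mathbf{a},\mathbf{C})$. For $r\in V$ let $\mathbf{X}_r=(X_{i,(r)},\,i\in V)=\Phi_r(\mathbf{S})$, where $\Phi_r$ is the transformation associated with the rooted tree $T_r$ and the parameters $c_{i,j}$, $c_i$ (defined in the context). Then, for any $r\in V$, the components of the random vector $\mathbf{X}_r$ are independent. Moreover, $$X_{r,(r)}\sim\mathcal{G}(a_r,c_r)\quad\text{and}\quad \frac{c_{\mathfrak{p}_r(i),i}}{c_{\mathfrak{p}_r(i)}}\,X_{i,(r)}\sim\mathcal{K}\left(a_i,\;a_{\mathfrak{p}_r(i)}-a_i,\;\frac{c_{\mathfrak{p}_r(i)}\,c_i}{c_{\mathfrak{p}_r(i),i}}\right),\quad i\in V\setminus\{r\}.$$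
   Context: A tree is a finite, connected, acyclic undirected graph $T=(V,E)$. A subtree $S$ of $T$, written $S\subseteq T$, is a tree $S=(V(S),E(S))$ with $\emptyset\neq V(S)\subseteq V$ and $E(S)=\{\{i,j\}\in E:\ i,j\in V(S)\}$ (in particular $S$ is connected; single vertices are allowed). $\deg_S(i)$ is the degree of vertex $i$ in $S$. For a root $r\in V$, $T_r$ denotes $T$ directed from $r$ towards the leaves; $\mathfrak{C}_r(i)$ is the set of children of $i$ in $T_r$, and $\mathfrak{p}_r(i)$ is the unique parent of $i\neq r$ in $T_r$. $C_T$ is the set of symmetric matrices $\mathbf{C}=[c_{i,j}]_{i,j\in V}$ with $c_{i,j}>0$ when $\{i,j\}\in E$, $c_{i,i}=:c_i>0$ for $i\in V$, and $c_{i,j}=0$ otherwise. Given $\mathbf{C}\in C_T$ and $r\in V$, the map $\Phi_r:(0,\infty)^p\to(0,\infty)^p$ is $\Phi_r(s_i,\,i\in V)=(s_{i,(r)},\,i\in V)$, where, recursively starting from the vertices farthest from $r$, $$s_{i,(r)}=s_i\prod_{j\in\mathfrak{C}_r(i)}\left(1+\frac{c_{i,j}}{c_i}\,s_{j,(r)}\right),$$ an empty product being equal to $1$. For $\mathbf{a}=(a_i,\,i\in V)\in(0,\infty)^p$ and $\mathbf{C}\in C_T$, the tree-Kummer distribution $\mathrm{TK}(\mathbf{a},\mathbf{C})$ is the probability distribution on $(0,\infty)^p$ with density $$f(\mathbf{x})\propto\prod_{i\in V}x_i^{a_i-1}\,\exp\left(-\sum_{S\subseteq T}\ \prod_{i\in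 V(S)}\frac{x_i}{c_i^{\deg_S(i)-1}}\prod_{\{j,k\}\in E(S)}c_{j,k}\right)\mathbf{1}_{(0,\infty)^p}(\mathbf{x}),$$ the sum being over all subtrees $S$ of $T$. For $\alpha,\gamma>0$ and $\beta\in\mathbb{R}$, the Kummer distribution $\mathcal{K}(\alpha,\beta,\gamma)$ has density proportional to $\frac{x^{\alpha-1}}{(1+x)^{\alpha+\beta}}e^{-\gamma x}\mathbf{1}_{(0,\infty)}(x)$; for $\alpha,\gamma>0$, the Gamma distribution $\mathcal{G}(\alpha,\gamma)$ has density proportional to $x^{\alpha-1}e^{-\gamma x}\mathbf{1}_{(0,\infty)}(x)$. *)

theory Defs
  imports "HOL-Probability.Probability"
begin

section \<open>Trees\<close>

definition undirected_graph :: "'v set \<Rightarrow> 'v set set \<Rightarrow> bool" where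
  "undirected_graph V E \<longleftrightarrow> (\<forall>e\<in>E. \<exists>u\<in>V. \<exists>v\<in>V. u \<noteq> v \<and> e = {u, v})"

definition walk :: "'v set \<Rightarrow> 'v set set \<Rightarrow> 'v \<Rightarrow> 'v list \<Rightarrow> 'v \<Rightarrow> bool" where
  "walk V E u xs v \<longleftrightarrow> xs \<noteq> [] \<and> set xs \<subseteq> V \<and> hd xs = u \<and> last xs = v \<and>
     successively (\<lambda>x y. {x, y} \<in> E) xs"

definition graph_connected :: "'v set \<Rightarrow> 'v set set \<Rightarrow> bool" where
  "graph_connected V E \<longleftrightarrow> (\<forall>u\<in>V. \<forall>v\<in>V. \<exists>xs. walk V E u xs v)"

text \<open>A cycle is listed without repeating its first vertex at the end.\<close>

definition graph_cycle :: "'v set \<Rightarrow> 'v set set \<Rightarrow> 'v list \<Rightarrow> bool" where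
  "graph_cycle V E xs \<longleftrightarrow> 3 \<le> length xs \<and> distinct xs \<and> walk V E (hd xs) xs (last xs) \<and>
     {last xs, hd xs} \<in> E"

definition tree_graph :: "'v set \<Rightarrow> 'v set set \<Rightarrow> bool" where
  "tree_graph V E \<longleftrightarrow> finite V \<and> undirected_graph V E \<and> graph_connected V E \<and>
     \<not> (\<exists>xs. graph_cycle V E xs)"

definition subtrees :: "'v set \<Rightarrow> 'v set set \<Rightarrow> ('v set \<times> 'v set set) set" where
  "subtrees V E = {(U, F). U \<noteq> {} \<and> U \<subseteq> V \<and> F = {e \<in> E. e \<subseteq> U} \<and> tree_graph U F}"

definition vertex_degree :: "'v set set \<Rightarrow> 'v \<Rightarrow> nat" where
  "vertex_degree F i = card {e \<in> F. i \<in> e}"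


section \<open>Rooted trees\<close>

definition graph_dist :: "'v set \<Rightarrow> 'v set set \<Rightarrow> 'v \<Rightarrow> 'v \<Rightarrow> nat" where
  "graph_dist V E u v = (LEAST n. \<exists>xs. walk V E u xs v \<and> length xs = Suc n)"

text \<open>Every edge of the tree is directed away from the root \<open>r\<close>, that is, from its endpoint nearer
  to \<open>r\<close> to the one farther from \<open>r\<close>.\<close>

definition children :: "'v set \<Rightarrow> 'v set set \<Rightarrow> 'v \<Rightarrow> 'v \<Rightarrow> 'v set" where
  "children V E r i = {j \<in> V. {i, j} \<in> E \<and> graph_dist V E r i < graph_dist V E r j}"

definition parent :: "'v set \<Rightarrow> 'v set set \<Rightarrow> 'v \<Rightarrow> 'v \<Rightarrow> 'v" where
  "parent V E r i = (THE k. k \<in> V \<and> i \<in> children V E r k)"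


section \<open>Weights and the transformation\<close>

text \<open>Matrices and vectors indexed by \<open>V\<close> are functions, of which only the values on \<open>V\<close> matter;
  \<open>C i i\<close> plays the role of \<open>c\<^sub>i\<close>.\<close>

definition weight_matrices :: "'v set \<Rightarrow> 'v set set \<Rightarrow> ('v \<Rightarrow> 'v \<Rightarrow> real) set" where
  "weight_matrices V E = {C.
     (\<forall>i\<in>V. \<forall>j\<in>V. C i j = C j i) \<and>
     (\<forall>i\<in>V. \<forall>j\<in>V. {i, j} \<in> E \<longrightarrow> 0 < C i j) \<and>
     (\<forall>i\<in>V. 0 < C i i) \<and>
     (\<forall>i\<in>V. \<forall>j\<in>V. i \<noteq> j \<and> {i, j} \<notin> E \<longrightarrow> C i j = 0)}"

text \<open>Well defined on edges because \<open>C\<close> is symmetric.\<close>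

definition edge_weight :: "('v \<Rightarrow> 'v \<Rightarrow> real) \<Rightarrow> 'v set \<Rightarrow> real" where
  "edge_weight C e = (THE w. \<exists>j k. e = {j, k} \<and> w = C j k)"

text \<open>The condition \<open>finite V\<close> is there for termination only. Vectors are extensional: they are
  \<open>undefined\<close> outside \<open>V\<close>, as in the product space \<open>\<Pi>\<^sub>M i\<in>V. lborel\<close>.\<close>

function tree_Phi ::
  "'v set \<Rightarrow> 'v set set \<Rightarrow> ('v \<Rightarrow> 'v \<Rightarrow> real) \<Rightarrow> 'v \<Rightarrow> ('v \<Rightarrow> real) \<Rightarrow> 'v \<Rightarrow> real" where
  "tree_Phi V E C r s i =
     (if finite V \<and> i \<in> V
      then s i * (\<Prod>j\<in>children V E r i. (1 + C i j / C i i * tree_Phi V E C r s j))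
      else undefined)"
  by pat_completeness auto
termination
proof (relation "Wellfounded.measure (\<lambda>(V, E, C, r, s, i). Max (graph_dist V E r ` V) - graph_dist V E r i)")
  fix V :: "'v set" and E C r s i j
  assume V: "finite V \<and> i \<in> V" and j: "j \<in> children V E r i"
  have "graph_dist V E r i < graph_dist V E r j"
    using j by (simp add: children_def)
  moreover have "graph_dist V E r j \<le> Max (graph_dist V E r ` V)"
    using V j by (intro Max_ge) (auto simp: children_def)
  ultimately show "((V, E, C, r, s, j), (V, E, C, r, s, i)) \<in>
      Wellfounded.measure (\<lambda>(V, E, C, r, s, i). Max (graph_dist V E r ` V) - graph_dist V E r i)"
    by simp
qed simp

declare tree_Phi.simps [simp del]


section \<open>Distributions\<close>

definition has_density_prop_to ::
  "'w measure \<Rightarrow> 'b measure \<Rightarrow> ('w \<Rightarrow> 'b) \<Rightarrow> ('b \<Rightarrow> real) \<Rightarrow> bool" where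
  "has_density_prop_to M N X g \<longleftrightarrow> (\<exists>K>0. distributed M N X (\<lambda>x. ennreal (K * g x)))"

text \<open>The exponent \<open>deg\<^sub>S(i) - 1\<close> equals \<open>-1\<close> for a single-vertex subtree, hence the integer power.\<close>

definition tree_Kummer_kernel ::
  "'v set \<Rightarrow> 'v set set \<Rightarrow> ('v \<Rightarrow> real) \<Rightarrow> ('v \<Rightarrow> 'v \<Rightarrow> real) \<Rightarrow> ('v \<Rightarrow> real) \<Rightarrow> real" where
  "tree_Kummer_kernel V E a C x =
     (\<Prod>i\<in>V. x i powr (a i - 1)) *
     exp (- (\<Sum>(U, F)\<in>subtrees V E.
              (\<Prod>i\<in>U. x i / C i i powi (int (vertex_degree F i) - 1)) *
              (\<Prod>e\<in>F. edge_weight C e))) *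
     indicator {x. \<forall>i\<in>V. 0 < x i} x"

definition tree_Kummer_distributed ::
  "'w measure \<Rightarrow> ('w \<Rightarrow> 'v \<Rightarrow> real) \<Rightarrow> 'v set \<Rightarrow> 'v set set \<Rightarrow> ('v \<Rightarrow> real) \<Rightarrow> ('v \<Rightarrow> 'v \<Rightarrow> real) \<Rightarrow> bool"
  where
  "tree_Kummer_distributed M S V E a C \<longleftrightarrow>
     has_density_prop_to M (\<Pi>\<^sub>M i\<in>V. lborel) S (tree_Kummer_kernel V E a C)"

definition Kummer_distributed ::
  "'w measure \<Rightarrow> ('w \<Rightarrow> real) \<Rightarrow> real \<Rightarrow> real \<Rightarrow> real \<Rightarrow> bool" where
  "Kummer_distributed M X \<alpha> \<beta> \<gamma> \<longleftrightarrow>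
     has_density_prop_to M lborel X
       (\<lambda>x. x powr (\<alpha> - 1) / (1 + x) powr (\<alpha> + \<beta>) * exp (- \<gamma> * x) * indicator {0<..} x)"

definition Gamma_distributed :: "'w measure \<Rightarrow> ('w \<Rightarrow> real) \<Rightarrow> real \<Rightarrow> real \<Rightarrow> bool" where
  "Gamma_distributed M X \<alpha> \<gamma> \<longleftrightarrow>
     has_density_prop_to M lborel X (\<lambda>x. x powr (\<alpha> - 1) * exp (- \<gamma> * x) * indicator {0<..} x)"

end

theory Submission
  imports Defs
begin

text \<open>
  The subtrees whose vertex nearest to the root is \<open>i\<close> contribute \<open>c\<^sub>i x\<^sub>i\<close> to the exponent of the
  tree-Kummer density, where \<open>x = \<Phi>\<^sub>r(s)\<close>; hence the exponential factorises in the coordinates \<open>x\<^sub>i\<close>.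
  The inverse of \<open>\<Phi>\<^sub>r\<close> is explicit, \<open>s\<^sub>i = x\<^sub>i / q\<^sub>i(x)\<close> with \<open>q\<^sub>i(x)\<close> the product of
  \<open>1 + (c\<^sub>i\<^sub>j / c\<^sub>i) x\<^sub>j\<close> over the children \<open>j\<close> of \<open>i\<close>, and it is triangular with Jacobian
  determinant the product of the \<open>1 / q\<^sub>i(x)\<close>. Since every vertex except the root is a child of exactly one
  vertex, the powers of the \<open>q\<^sub>i\<close> regroup into one factor per coordinate, and the density of
  \<open>\<Phi>\<^sub>r(S)\<close> is a product.
\<close>

section \<open>Parents in a rooted tree\<close>

text \<open>As a set of ordered pairs the adjacency turns connectivity into a reflexive transitive
  closure, and deleting an edge becomes a set difference.\<close>

definition adj :: "'v set \<Rightarrow> 'v set set \<Rightarrow> ('v \<times> 'v) set" where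
  "adj V E = {(x, y). x \<in> V \<and> y \<in> V \<and> {x, y} \<in> E}"

lemma sym_adj: "sym (adj V E)"
  by (auto simp: adj_def sym_def insert_commute)

lemma walk_imp_rtrancl_adj: "walk V E u xs v \<Longrightarrow> (u, v) \<in> (adj V E)\<^sup>*"
proof (induction xs arbitrary: u)
  case Nil
  then show ?case by (simp add: walk_def)
next
  case (Cons x xs)
  show ?case
  proof (cases "xs = []")
    case True
    with Cons.prems show ?thesis by (auto simp: walk_def)
  next
    case False
    with Cons.prems have "walk V E (hd xs) xs v" "(u, hd xs) \<in> adj V E"
      by (auto simp: walk_def successively_Cons adj_def)
    with Cons.IH show ?thesis by (meson converse_rtrancl_into_rtrancl)
  qed
qed

text \<open>Built from the far end: when the new first vertex already lies on the path, the path is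
  cut back to that occurrence instead of being extended.\<close>

lemma rtrancl_imp_distinct_path:
  assumes "(u, v) \<in> R\<^sup>*"
  shows "\<exists>xs. xs \<noteq> [] \<and> hd xs = u \<and> last xs = v \<and> distinct xs \<and>
    set xs \<subseteq> insert u (Range R) \<and> successively (\<lambda>x y. (x, y) \<in> R) xs"
  using assms
proof (induction rule: converse_rtrancl_induct)
  case base
  show ?case by (rule exI[of _ "[v]"]) simp
next
  case (step u y)
  then obtain xs where xs: "xs \<noteq> []" "hd xs = y" "last xs = v" "distinct xs"
    "set xs \<subseteq> insert y (Range R)" "successively (\<lambda>x y. (x, y) \<in> R) xs" by blast
  show ?case
  proof (cases "u \<in> set xs")
    case True
    then obtain ys zs where "xs = ys @ u # zs" by (meson split_list)
    with xs step.hyps(1) show ?thesis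
      by (intro exI[of _ "u # zs"]) (auto simp: successively_append_iff)
  next
    case False
    with xs step.hyps(1) show ?thesis
      by (intro exI[of _ "u # xs"]) (auto simp: successively_Cons)
  qed
qed

lemma adj_rtrancl_imp_walk:
  assumes "(u, v) \<in> (adj V E)\<^sup>*" "u \<in> V"
  shows "\<exists>xs. walk V E u xs v"
proof -
  obtain xs where xs: "xs \<noteq> []" "hd xs = u" "last xs = v" "set xs \<subseteq> insert u (Range (adj V E))"
      "successively (\<lambda>x y. (x, y) \<in> adj V E) xs"
    using rtrancl_imp_distinct_path[OF assms(1)] by blast
  have "successively (\<lambda>x y. {x, y} \<in> E) xs"
    using xs(5) by (rule successively_mono) (auto simp: adj_def)
  with xs assms(2) show ?thesis
    by (intro exI[of _ xs]) (auto simp: walk_def adj_def)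
qed

lemma graph_connected_iff:
  "graph_connected V E \<longleftrightarrow> (\<forall>u\<in>V. \<forall>v\<in>V. (u, v) \<in> (adj V E)\<^sup>*)"
  unfolding graph_connected_def using walk_imp_rtrancl_adj adj_rtrancl_imp_walk by metis

lemma tree_edgeD:
  assumes "tree_graph V E" "{u, w} \<in> E"
  shows "u \<in> V" "w \<in> V" "u \<noteq> w"
  using assms by (auto simp: tree_graph_def undirected_graph_def doubleton_eq_iff)

text \<open>A repetition-free path joining the ends of the edge without using it would close up with
  the edge to a cycle. It has at least three vertices, because the two-vertex path is the deleted
  edge itself.\<close>

lemma tree_edge_is_bridge:
  assumes T: "tree_graph V E" and e: "{u, w} \<in> E"
  shows "(u, w) \<notin> (adj V E - {(u, w), (w, u)})\<^sup>*"
proof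
  note uw = tree_edgeD[OF T e]
  let ?R = "adj V E - {(u, w), (w, u)}"
  assume "(u, w) \<in> ?R\<^sup>*"
  then obtain xs where xs: "xs \<noteq> []" "hd xs = u" "last xs = w" "distinct xs"
      "set xs \<subseteq> insert u (Range ?R)" "successively (\<lambda>x y. (x, y) \<in> ?R) xs"
    using rtrancl_imp_distinct_path by metis
  have "3 \<le> length xs"
  proof (rule ccontr)
    assume "\<not> ?thesis"
    then consider "length xs = 0" | "length xs = Suc 0" | "length xs = Suc (Suc 0)" by linarith
    then show False using xs uw by cases (auto simp: length_Suc_conv)
  qed
  moreover have "successively (\<lambda>x y. {x, y} \<in> E) xs"
    using xs(6) by (rule successively_mono) (auto simp: adj_def)
  ultimately have "graph_cycle V E xs"
    using xs e uw by (auto simp: graph_cycle_def walk_def adj_def insert_commute)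
  with T show False by (auto simp: tree_graph_def)
qed

section \<open>Distances to the root and the unique parent\<close>

lemma graph_dist_root: "r \<in> V \<Longrightarrow> graph_dist V E r r = 0"
  unfolding graph_dist_def by (rule Least_eq_0) (auto simp: walk_def intro!: exI[of _ "[r]"])

text \<open>The last vertex but one of a shortest walk from \<open>r\<close> to \<open>j\<close>
  works, since dropping \<open>j\<close> leaves a shorter walk from \<open>r\<close>.\<close>

lemma closer_neighbour:
  assumes T: "tree_graph V E" and r: "r \<in> V" and j: "j \<in> V" "j \<noteq> r"
  shows "\<exists>k\<in>V. {k, j} \<in> E \<and> graph_dist V E r k < graph_dist V E r j"
proof -
  obtain ys where ys: "walk V E r ys j"
    using T r j unfolding tree_graph_def graph_connected_def by meson
  let ?P = "\<lambda>n. \<exists>xs. walk V E r xs j \<and> length xs = Suc n"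
  have "?P (length ys - 1)"
    using ys by (auto simp: walk_def intro!: exI[of _ ys])
  then have "?P (graph_dist V E r j)"
    unfolding graph_dist_def by (rule LeastI)
  then obtain xs where xs: "walk V E r xs j" "length xs = Suc (graph_dist V E r j)" by blast
  obtain zs where zs: "xs = zs @ [j]"
    using xs(1) unfolding walk_def by (metis append_butlast_last_id)
  have "zs \<noteq> []" using zs xs(1) j by (auto simp: walk_def)
  then have w: "walk V E r zs (last zs)" and "{last zs, j} \<in> E" "last zs \<in> V"
    using xs(1) zs by (auto simp: walk_def successively_append_iff)
  moreover have "graph_dist V E r (last zs) \<le> length zs - 1"
    unfolding graph_dist_def using w \<open>zs \<noteq> []\<close> by (intro Least_le) auto
  moreover have "length zs - 1 < graph_dist V E r j"
    using zs xs(2) \<open>zs \<noteq> []\<close> by (cases zs) auto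
  ultimately show ?thesis by force
qed

text \<open>Iterates \<open>closer_neighbour\<close>. The two distance bounds recorded in the
  relation serve later to certify that such a path misses a given edge.\<close>

lemma descending_path_to_root:
  assumes T: "tree_graph V E" and r: "r \<in> V" and u: "u \<in> V"
  shows "(u, r) \<in> {(x, y) \<in> adj V E. graph_dist V E r y < graph_dist V E r x \<and>
    graph_dist V E r x \<le> graph_dist V E r u}\<^sup>*"
  using u
proof (induction u rule: measure_induct_rule[of "graph_dist V E r"])
  case (less u)
  show ?case
  proof (cases "u = r")
    case False
    with closer_neighbour[OF T r less.prems] obtain k where
      k: "k \<in> V" "{k, u} \<in> E" "graph_dist V E r k < graph_dist V E r u" by blast
    note less.IH[OF k(3,1)]
    then have "(k, r) \<in> {(x, y) \<in> adj V E. graph_dist V E r y < graph_dist V E r x \<and>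
        graph_dist V E r x \<le> graph_dist V E r u}\<^sup>*"
      by (rule rtrancl_mono[THEN subsetD, rotated]) (use k(3) in auto)
    then show ?thesis
      by (rule converse_rtrancl_into_rtrancl[rotated])
        (use k less.prems in \<open>auto simp: adj_def insert_commute\<close>)
  qed simp
qed

lemma sym_adj_minus_edge: "sym (adj V E - {(u, w), (w, u)})"
  using sym_adj[of V E] by (auto simp: sym_def)

text \<open>Otherwise the descending paths of the two ends to the root bypass the edge.\<close>

lemma graph_dist_edge_neq:
  assumes T: "tree_graph V E" and r: "r \<in> V" and e: "{u, w} \<in> E"
  shows "graph_dist V E r u \<noteq> graph_dist V E r w"
proof
  assume eq: "graph_dist V E r u = graph_dist V E r w"
  let ?R = "adj V E - {(u, w), (w, u)}"
  have to_r: "(x, r) \<in> ?R\<^sup>*" if "x \<in> V" for x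
    using descending_path_to_root[OF T r that]
    by (rule rtrancl_mono[THEN subsetD, rotated]) (use eq in auto)
  have "(r, w) \<in> ?R\<^sup>*"
    using to_r[of w] tree_edgeD[OF T e] sym_rtrancl[OF sym_adj_minus_edge] by (meson symD)
  with to_r[of u] tree_edgeD[OF T e] tree_edge_is_bridge[OF T e] show False
    by (meson rtrancl_trans)
qed

text \<open>Two distinct closer neighbours would give a detour: descend from \<open>k\<close> to
  \<open>r\<close>, climb to \<open>l\<close>, step to \<open>j\<close>. The descending paths start
  below the level of \<open>j\<close>, so they never meet the edge between \<open>k\<close> and
  \<open>j\<close>, which contradicts its being a bridge.\<close>

lemma closer_neighbour_unique:
  assumes T: "tree_graph V E" and r: "r \<in> V"
    and k: "{k, j} \<in> E" "graph_dist V E r k < graph_dist V E r j"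
    and l: "{l, j} \<in> E" "graph_dist V E r l < graph_dist V E r j"
  shows "k = l"
proof (rule ccontr)
  assume "k \<noteq> l"
  let ?R = "adj V E - {(k, j), (j, k)}"
  note kj = tree_edgeD[OF T k(1)] and lj = tree_edgeD[OF T l(1)]
  have to_r: "(x, r) \<in> ?R\<^sup>*" if "x \<in> V" "graph_dist V E r x < graph_dist V E r j" for x
    using descending_path_to_root[OF T r that(1)]
    by (rule rtrancl_mono[THEN subsetD, rotated]) (use that in auto)
  have "(r, l) \<in> ?R\<^sup>*"
    using to_r[of l] lj l(2) sym_rtrancl[OF sym_adj_minus_edge] by (meson symD)
  moreover have "(l, j) \<in> ?R"
    using \<open>k \<noteq> l\<close> l(1) lj by (auto simp: adj_def)
  ultimately have "(k, j) \<in> ?R\<^sup>*"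
    using to_r[of k] kj k(2) by (meson rtrancl_trans rtrancl_into_rtrancl)
  with tree_edge_is_bridge[OF T k(1)] show False by blast
qed

lemma child_unique_parent:
  assumes T: "tree_graph V E" and r: "r \<in> V"
    and "j \<in> children V E r i" "j \<in> children V E r k"
  shows "i = k"
  using closer_neighbour_unique[OF T r] assms(3,4) unfolding children_def by blast

lemma parent_eqI:
  assumes T: "tree_graph V E" and r: "r \<in> V" and j: "j \<in> children V E r k"
  shows "parent V E r j = k"
  unfolding parent_def
proof (rule the_equality)
  show "k \<in> V \<and> j \<in> children V E r k"
    using j tree_edgeD[OF T] by (auto simp: children_def)
qed (use child_unique_parent[OF T r j] in blast)

lemma child_of_parent:
  assumes T: "tree_graph V E" and r: "r \<in> V" and j: "j \<in> V" "j \<noteq> r"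
  shows "j \<in> children V E r (parent V E r j)" "parent V E r j \<in> V"
proof -
  obtain k where "k \<in> V" "j \<in> children V E r k"
    using closer_neighbour[OF T r j] j by (auto simp: children_def)
  with parent_eqI[OF T r] show "j \<in> children V E r (parent V E r j)" "parent V E r j \<in> V"
    by auto
qed

text \<open>Sets of children become fibres of the parent map, so a double product over vertices and
  their children can be regrouped into one product over the non-root vertices.\<close>

lemma children_eq_parent_fibre:
  assumes T: "tree_graph V E" and r: "r \<in> V"
  shows "children V E r i = {j \<in> V. j \<noteq> r \<and> parent V E r j = i}"
proof (intro equalityI subsetI CollectI conjI)
  fix j assume j: "j \<in> children V E r i"
  then show "j \<in> V" "j \<noteq> r" "parent V E r j = i"
    using graph_dist_root[OF r] parent_eqI[OF T r j] by (auto simp: children_def)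
next
  fix j assume "j \<in> {j \<in> V. j \<noteq> r \<and> parent V E r j = i}"
  then show "j \<in> children V E r i" using child_of_parent[OF T r] by blast
qed

text \<open>The ends of an edge never have equal distance to \<open>r\<close>, hence the farther one
  is a child of the nearer one.\<close>

lemma edges_eq_parent_edges:
  assumes T: "tree_graph V E" and r: "r \<in> V"
  shows "E = (\<lambda>j. {parent V E r j, j}) ` (V - {r})"
proof (intro equalityI subsetI)
  fix e assume e: "e \<in> E"
  with T obtain u w where uw: "u \<in> V" "w \<in> V" "e = {u, w}"
    by (auto simp: tree_graph_def undirected_graph_def)
  with graph_dist_edge_neq[OF T r, of u w] e
  have "w \<in> children V E r u \<or> u \<in> children V E r w"
    by (auto simp: children_def insert_commute)
  with uw show "e \<in> (\<lambda>j. {parent V E r j, j}) ` (V - {r})"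
    unfolding children_eq_parent_fibre[OF T r] by (auto simp: insert_commute)
next
  fix e assume "e \<in> (\<lambda>j. {parent V E r j, j}) ` (V - {r})"
  with child_of_parent[OF T r] show "e \<in> E" by (auto simp: children_def)
qed

section \<open>The sum over the subtrees\<close>

text \<open>When \<open>p\<close> is the parent map, these are the roots of the components of the
  forest induced by \<open>U\<close>; a subtree is the case of exactly one top.\<close>

definition tops :: "('v \<Rightarrow> 'v) \<Rightarrow> 'v \<Rightarrow> 'v set \<Rightarrow> 'v set" where
  "tops p r U = {j \<in> U. j = r \<or> p j \<notin> U}"

text \<open>A vertex that is not a top stands for the edge to its parent, whose factor is
  \<open>\<kappa>\<close>. Keeping \<open>p\<close>, \<open>c\<close>, \<open>\<kappa>\<close> and
  \<open>s\<close> abstract lets the induction below shrink the vertex set and change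
  \<open>s\<close> without carrying a tree along.\<close>

definition forest_weight ::
  "('v \<Rightarrow> 'v) \<Rightarrow> 'v \<Rightarrow> ('v \<Rightarrow> real) \<Rightarrow> ('v \<Rightarrow> real) \<Rightarrow> ('v \<Rightarrow> real) \<Rightarrow> 'v set \<Rightarrow> real" where
  "forest_weight p r c \<kappa> s U =
     (\<Prod>i\<in>U. s i) * (\<Prod>i\<in>tops p r U. c i) * (\<Prod>i\<in>U - tops p r U. \<kappa> i)"

text \<open>A vertex of \<open>U\<close> minimising \<open>d\<close> cannot have its parent in
  \<open>U\<close>, so it would be a top.\<close>

lemma tops_eq_empty:
  fixes d :: "'v \<Rightarrow> nat"
  assumes "finite U" "tops p r U = {}" and d: "\<And>j. j \<in> U \<Longrightarrow> j \<noteq> r \<Longrightarrow> d (p j) < d j"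
  shows "U = {}"
proof (rule ccontr)
  assume "U \<noteq> {}"
  then obtain j where "is_arg_min d (\<lambda>j. j \<in> U) j"
    using ex_is_arg_min_if_finite[OF assms(1)] by blast
  then have "j \<in> U" "\<And>k. k \<in> U \<Longrightarrow> \<not> d k < d j"
    by (auto simp: is_arg_min_def)
  with d have "j \<in> tops p r U" by (auto simp: tops_def)
  with assms(2) show False by simp
qed

text \<open>Removing the deepest vertex \<open>l\<close> amounts to rescaling \<open>s\<close> at the parent of \<open>l\<close>.\<close>

lemma sum_forest_weight:
  fixes d :: "'v \<Rightarrow> nat"
  assumes "finite A"
    and "\<And>j. j \<in> A \<Longrightarrow> j \<noteq> r \<Longrightarrow> d (p j) < d j"
    and "\<And>i. i \<in> A \<Longrightarrow> x i = s i * (\<Prod>j\<in>{j \<in> A. j \<noteq> r \<and> p j = i}. 1 + \<kappa> j * x j)"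
  shows "(\<Sum>U | U \<subseteq> A \<and> (\<exists>t. tops p r U = {t}). forest_weight p r c \<kappa> s U) = (\<Sum>i\<in>A. c i * x i)"
  using assms
proof (induction A arbitrary: s rule: finite_ranking_induct[where f = d])
  case empty
  have "{U. U \<subseteq> {} \<and> (\<exists>t. tops p r U = {t})} = {}" by (auto simp: tops_def)
  then show ?case by (simp only: sum.empty)
next
  case (insert l A)
  show ?case
  proof (cases "l \<in> A")
    case True
    with insert show ?thesis by (simp add: insert_absorb)
  next
    case False
    define s' where "s' = (\<lambda>i. s i * (if l \<noteq> r \<and> i = p l then 1 + \<kappa> l * s l else 1))"
    have dec: "d (p j) < d j" if "j = l \<or> j \<in> A" "j \<noteq> r" for j
      using insert.prems(1) that by auto
    have no_child: "p j \<noteq> l" if "j = l \<or> j \<in> A" "j \<noteq> r" for j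
      using dec[OF that] insert.hyps(2)[of j] that by auto
    then have "{j \<in> insert l A. j \<noteq> r \<and> p j = l} = {}" by auto
    then have xl: "x l = s l" using insert.prems(2)[of l] by (simp only: prod.empty) simp
    \<comment> \<open>The factor that \<open>l\<close> contributes to the product at its parent
      moves into \<open>s'\<close>, so the recursion persists on \<open>A\<close> with
      \<open>s'\<close> in place of \<open>s\<close>.\<close>
    have rec: "x i = s' i * (\<Prod>j\<in>{j \<in> A. j \<noteq> r \<and> p j = i}. 1 + \<kappa> j * x j)" if i: "i \<in> A" for i
    proof -
      have "{j \<in> insert l A. j \<noteq> r \<and> p j = i} =
          (if l \<noteq> r \<and> i = p l then insert l {j \<in> A. j \<noteq> r \<and> p j = i} else {j \<in> A. j \<noteq> r \<and> p j = i})"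
        by auto
      with insert.prems(2)[of i] i False \<open>finite A\<close> show ?thesis
        by (simp add: s'_def xl split: if_splits)
    qed
    let ?B = "\<lambda>A. {U. U \<subseteq> A \<and> (\<exists>t. tops p r U = {t})}"
    let ?w = "forest_weight p r c \<kappa> s"
    let ?G = "{U \<in> ?B A. l \<noteq> r \<and> p l \<in> U}"
    have fin: "finite (?B A)" by (rule finite_subset[of _ "Pow A"]) (use \<open>finite A\<close> in auto)
    have finG: "finite (insert l ` ?G)" by (intro finite_imageI finite_subset[OF _ fin]) auto
    have finU: "finite U" if "U \<subseteq> A" for U using that \<open>finite A\<close> finite_subset by auto
    have tops_ins: "tops p r (insert l U) = tops p r U \<union> (if l = r \<or> p l \<notin> U then {l} else {})"
      if "U \<subseteq> A" for U
      using that no_child by (auto simp: tops_def)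
    \<comment> \<open>A one-top set either avoids \<open>l\<close>, or is \<open>{l}\<close>, or
      arises by adding \<open>l\<close> to a one-top set that contains the parent of
      \<open>l\<close>. If \<open>l\<close> is itself the only top, the rest has no top and is
      empty.\<close>
    have B: "?B (insert l A) = ?B A \<union> ({{l}} \<union> insert l ` ?G)"
    proof (intro equalityI subsetI)
      fix U assume U: "U \<in> ?B (insert l A)"
      show "U \<in> ?B A \<union> ({{l}} \<union> insert l ` ?G)"
      proof (cases "l \<in> U")
        case True
        define U' where "U' = U - {l}"
        have U': "U = insert l U'" "U' \<subseteq> A" "l \<notin> U'" using True U by (auto simp: U'_def)
        show ?thesis
        proof (cases "l = r \<or> p l \<notin> U'")
          case t: True
          have "l \<notin> tops p r U'" using U'(3) by (simp add: tops_def)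
          with U t tops_ins[OF U'(2)] have "tops p r U' = {}" unfolding U'(1) by auto
          then have "U' = {}"
            by (rule tops_eq_empty[OF finU[OF U'(2)], where d = d]) (use dec U' in auto)
          with U' show ?thesis by simp
        next
          case f: False
          with tops_ins[OF U'(2)] have "tops p r U = tops p r U'" by (simp add: U'(1))
          with U U' f show ?thesis by auto
        qed
      qed (use U in auto)
    next
      fix U assume "U \<in> ?B A \<union> ({{l}} \<union> insert l ` ?G)"
      then consider "U \<in> ?B A" | "U = {l}" | U' where "U' \<in> ?G" "U = insert l U'" by blast
      then show "U \<in> ?B (insert l A)"
      proof cases
        case 2
        have "tops p r {l} = {l}" using no_child by (auto simp: tops_def)
        with 2 show ?thesis by auto
      next
        case 3
        with tops_ins[of U'] have "tops p r U = tops p r U'" by auto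
        with 3 show ?thesis by auto
      qed auto
    qed
    have "sum ?w (?B (insert l A)) = sum ?w (?B A) + (?w {l} + sum ?w (insert l ` ?G))"
      unfolding B
    proof (subst sum.union_disjoint)
      show "?B A \<inter> ({{l}} \<union> insert l ` ?G) = {}" using False by auto
      have "{l} \<notin> insert l ` ?G"
      proof
        assume "{l} \<in> insert l ` ?G"
        then obtain U where U: "U \<subseteq> A" "l \<noteq> r" "p l \<in> U" "{l} = insert l U" by auto
        then have "p l = l" by blast
        with no_child[of l] U show False by auto
      qed
      then show "sum ?w (?B A) + sum ?w ({{l}} \<union> insert l ` ?G) =
          sum ?w (?B A) + (?w {l} + sum ?w (insert l ` ?G))"
        using finG sum.insert[of "insert l ` ?G" "{l}" ?w] by simp
    qed (use fin finG in simp_all)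
    also have "sum ?w (insert l ` ?G) = (\<Sum>U\<in>?G. ?w (insert l U))"
      by (rule sum.reindex_cong[of "insert l"]) (use False in \<open>auto simp: inj_on_def\<close>)
    also have "\<dots> = (\<Sum>U\<in>?G. ?w U * (\<kappa> l * s l))"
    proof (rule sum.cong[OF refl])
      fix U assume U: "U \<in> ?G"
      then have t: "tops p r (insert l U) = tops p r U" using tops_ins[of U] by auto
      have "l \<notin> U" "l \<notin> tops p r U" using U False by (auto simp: tops_def)
      then have "insert l U - tops p r U = insert l (U - tops p r U)" by auto
      then show "?w (insert l U) = ?w U * (\<kappa> l * s l)"
        unfolding forest_weight_def t using finU[of U] U \<open>l \<notin> U\<close> by simp
    qed
    also have "\<dots> = (\<Sum>U\<in>?B A. if l \<noteq> r \<and> p l \<in> U then ?w U * (\<kappa> l * s l) else 0)"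
      using fin by (subst sum.inter_filter[symmetric]) auto
    also have "?w {l} = c l * x l"
    proof -
      have "tops p r {l} = {l}" using no_child by (auto simp: tops_def)
      then show ?thesis by (simp add: forest_weight_def xl)
    qed
    finally have 1: "sum ?w (?B (insert l A)) = c l * x l +
        (\<Sum>U\<in>?B A. ?w U + (if l \<noteq> r \<and> p l \<in> U then ?w U * (\<kappa> l * s l) else 0))"
      by (simp add: sum.distrib)
    \<comment> \<open>The sets \<open>U\<close> and \<open>insert l U\<close> are summed together:
      their joint weight is that of \<open>U\<close> with \<open>s\<close> at the parent multiplied
      by \<open>1 + \<kappa> l * s l\<close>.\<close>
    have "?w U + (if l \<noteq> r \<and> p l \<in> U then ?w U * (\<kappa> l * s l) else 0) =
        forest_weight p r c \<kappa> s' U" if "U \<in> ?B A" for U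
    proof -
      have "(\<Prod>i\<in>U. s' i) = (\<Prod>i\<in>U. s i) * (if l \<noteq> r \<and> p l \<in> U then 1 + \<kappa> l * s l else 1)"
        using finU[of U] that by (cases "l = r") (simp_all add: s'_def prod.distrib prod.delta)
      then show ?thesis by (simp add: forest_weight_def algebra_simps)
    qed
    then have "sum ?w (?B (insert l A)) = c l * x l + sum (forest_weight p r c \<kappa> s') (?B A)"
      unfolding 1 by simp
    also have "sum (forest_weight p r c \<kappa> s') (?B A) = (\<Sum>i\<in>A. c i * x i)"
      by (rule insert.IH[OF _ rec]) (use dec in auto)
    finally show ?thesis using False \<open>finite A\<close> by simp
  qed
qed

section \<open>Subtrees as vertex sets with a single top\<close>

text \<open>Finiteness, undirectedness and acyclicity are inherited from \<open>T\<close>'s graph,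
  so only connectivity matters. With one top, every vertex climbs to it through parents inside
  \<open>U\<close>; conversely, connectivity forces all tops to coincide.\<close>

lemma tree_graph_induced_iff:
  assumes T: "tree_graph V E" and r: "r \<in> V" and U: "U \<subseteq> V"
  shows "U \<noteq> {} \<and> tree_graph U {e \<in> E. e \<subseteq> U} \<longleftrightarrow> (\<exists>t. tops (parent V E r) r U = {t})"
    (is "?L \<longleftrightarrow> ?R")
proof -
  let ?p = "parent V E r" and ?F = "{e \<in> E. e \<subseteq> U}" and ?d = "graph_dist V E r"
  have par: "{?p j, j} \<in> E" "?d (?p j) < ?d j" if "j \<in> U" "j \<noteq> r" for j
    using child_of_parent(1)[OF T r, of j] that U by (auto simp: children_def)
  have finU: "finite U" using T U finite_subset by (auto simp: tree_graph_def)
  have to_parent: "(j, ?p j) \<in> adj U ?F" if "j \<in> U - tops ?p r U" for j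
    using that par[of j] by (auto simp: tops_def adj_def insert_commute)
  have undir: "undirected_graph U ?F"
    using T by (fastforce simp: tree_graph_def undirected_graph_def)
  have no_cycle: "\<not> graph_cycle U ?F xs" for xs
  proof
    assume "graph_cycle U ?F xs"
    then have "graph_cycle V E xs"
      using U by (auto simp: graph_cycle_def walk_def elim: successively_mono)
    with T show False by (auto simp: tree_graph_def)
  qed
  show ?thesis
  proof
    assume ?R
    then obtain t where t: "tops ?p r U = {t}" ..
    have to_t: "(j, t) \<in> (adj U ?F)\<^sup>*" if "j \<in> U" for j
      using that
    proof (induction j rule: measure_induct_rule[of ?d])
      case (less j)
      show ?case
      proof (cases "j = t")
        case False
        with less.prems t have j: "j \<noteq> r" "?p j \<in> U" by (auto simp: tops_def)
        with less.IH[of "?p j"] less.prems par have "(?p j, t) \<in> (adj U ?F)\<^sup>*" by blast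
        moreover have "(j, ?p j) \<in> adj U ?F" using to_parent False less.prems t by blast
        ultimately show ?thesis by (rule converse_rtrancl_into_rtrancl[rotated])
      qed simp
    qed
    have "graph_connected U ?F"
      unfolding graph_connected_iff
      using to_t sym_rtrancl[OF sym_adj] by (meson symD rtrancl_trans)
    with undir no_cycle finU t show ?L by (auto simp: tree_graph_def tops_def)
  next
    assume L: ?L
    have "tops ?p r U \<noteq> {}"
      using tops_eq_empty[OF finU, of ?p r ?d] par L by blast
    then obtain t where t: "t \<in> tops ?p r U" by blast
    define N where "N = {(j, ?p j) | j. j \<in> U - tops ?p r U}"
    \<comment> \<open>The vertices lying below \<open>t\<close> inside \<open>U\<close> are closed under adjacency.\<close>
    have closed: "(v, t) \<in> N\<^sup>*" if uv: "(u, v) \<in> adj U ?F" and u: "(u, t) \<in> N\<^sup>*" for u v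
    proof -
      from uv have "u \<in> U" "v \<in> U" "{u, v} \<in> E" by (auto simp: adj_def)
      have "{u, v} \<in> (\<lambda>j. {?p j, j}) ` (V - {r})"
        using edges_eq_parent_edges[OF T r] \<open>{u, v} \<in> E\<close> by (rule subst)
      then obtain w where "w \<in> V - {r}" "{u, v} = {?p w, w}" by blast
      then consider "v \<noteq> r" "?p v = u" | "u \<noteq> r" "?p u = v"
        by (auto simp: doubleton_eq_iff)
      then show ?thesis
      proof cases
        case 1
        then have "(v, u) \<in> N" using \<open>u \<in> U\<close> \<open>v \<in> U\<close> by (auto simp: N_def tops_def)
        with u show ?thesis by (rule converse_rtrancl_into_rtrancl[rotated])
      next
        case 2
        \<comment> \<open>Since \<open>u\<close> is not a top it differs from \<open>t\<close>, so
          its climb to \<open>t\<close> must begin with the step to its parent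
          \<open>v\<close>.\<close>
        then have "u \<notin> tops ?p r U" using \<open>v \<in> U\<close> by (auto simp: tops_def)
        with t have "u \<noteq> t" by blast
        with u obtain z where "(u, z) \<in> N" "(z, t) \<in> N\<^sup>*" by (meson converse_rtranclE)
        with 2 show ?thesis by (auto simp: N_def)
      qed
    qed
    \<comment> \<open>Connectivity makes any other top climb to \<open>t\<close> along
      \<open>N\<close>, but no step of \<open>N\<close> starts at a top.\<close>
    have "t' = t" if t': "t' \<in> tops ?p r U" for t'
    proof -
      have "(t, t') \<in> (adj U ?F)\<^sup>*"
        using L t t' by (auto simp: tree_graph_def graph_connected_iff tops_def)
      then have "(t', t) \<in> N\<^sup>*"
        by (induction rule: rtrancl_induct) (use closed in auto)
      with t' show ?thesis by (auto simp: N_def elim: converse_rtranclE)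
    qed
    with t show ?R by blast
  qed
qed

lemma edge_weight_pair:
  assumes "C \<in> weight_matrices V E" "j \<in> V" "k \<in> V"
  shows "edge_weight C {j, k} = C j k"
  unfolding edge_weight_def
  using assms by (intro the_equality) (auto simp: weight_matrices_def doubleton_eq_iff)

text \<open>The degree of \<open>i\<close> counts its children in \<open>U\<close>, plus one for its
  parent unless \<open>i\<close> is a top. The exponent degree minus one therefore leaves one factor
  \<open>1 / C i i\<close> for each child, and a surplus factor \<open>C i i\<close> at the top.
  Attaching each \<open>1 / C i i\<close> to the edge leading to that child gives the forest
  weight.\<close>

lemma subtree_weight_eq:
  assumes T: "tree_graph V E" and r: "r \<in> V" and U: "U \<subseteq> V"
    and C: "C \<in> weight_matrices V E"
  defines "p \<equiv> parent V E r" and "F \<equiv> {e \<in> E. e \<subseteq> U}"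
  shows "(\<Prod>i\<in>U. x i / C i i powi (int (vertex_degree F i) - 1)) * (\<Prod>e\<in>F. edge_weight C e) =
    forest_weight p r (\<lambda>i. C i i) (\<lambda>j. C (p j) j / C (p j) (p j)) x U"
proof -
  define N where "N = U - tops p r U"
  have N: "N = {j \<in> U. j \<noteq> r \<and> p j \<in> U}" by (auto simp: N_def tops_def)
  have finU: "finite U" using T U finite_subset by (auto simp: tree_graph_def)
  have par: "graph_dist V E r (p j) < graph_dist V E r j" if "j \<in> N" for j
    using child_of_parent(1)[OF T r, of j] that U by (auto simp: children_def p_def N)
  have inj: "inj_on (\<lambda>j. {p j, j}) N"
  proof (rule inj_onI)
    fix j k assume "j \<in> N" "k \<in> N" "{p j, j} = {p k, k}"
    with par[of j] par[of k] show "j = k" by (auto simp: doubleton_eq_iff)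
  qed
  have F: "F = (\<lambda>j. {p j, j}) ` N"
    unfolding F_def edges_eq_parent_edges[OF T r, folded p_def] N using U by auto
  have pos: "C i i > 0" if "i \<in> U" for i
    using C U that by (auto simp: weight_matrices_def)
  have deg: "vertex_degree F i = (if i \<in> N then 1 else 0) + card {j \<in> N. p j = i}" for i
  proof -
    have "{e \<in> F. i \<in> e} = (\<lambda>j. {p j, j}) ` {j \<in> N. j = i \<or> p j = i}" by (auto simp: F)
    then have "vertex_degree F i = card {j \<in> N. j = i \<or> p j = i}"
      unfolding vertex_degree_def by (simp add: card_image inj_on_subset[OF inj])
    also have "{j \<in> N. j = i \<or> p j = i} = (if i \<in> N then {i} else {}) \<union> {j \<in> N. p j = i}"
      by auto
    also have "card \<dots> = card (if i \<in> N then {i} else {}) + card {j \<in> N. p j = i}"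
      using par[of i] finU by (intro card_Un_disjoint) (auto simp: N)
    finally show ?thesis by simp
  qed
  have edges: "(\<Prod>e\<in>F. edge_weight C e) = (\<Prod>j\<in>N. C (p j) j)"
    unfolding F using U
    by (subst prod.reindex[OF inj]) (auto simp: N intro!: prod.cong edge_weight_pair[OF C])
  have "(\<Prod>i\<in>U. x i / C i i powi (int (vertex_degree F i) - 1)) =
      (\<Prod>i\<in>U. x i * (if i \<in> tops p r U then C i i else 1) / C i i ^ card {j \<in> N. p j = i})"
  proof (rule prod.cong[OF refl])
    fix i assume i: "i \<in> U"
    have "C i i powi (int (vertex_degree F i) - 1) =
        C i i ^ card {j \<in> N. p j = i} / (if i \<in> tops p r U then C i i else 1)"
      using i pos[OF i] by (simp add: deg N_def power_int_diff power_int_add)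
    then show "x i / C i i powi (int (vertex_degree F i) - 1) =
        x i * (if i \<in> tops p r U then C i i else 1) / C i i ^ card {j \<in> N. p j = i}"
      by simp
  qed
  also have "\<dots> = (\<Prod>i\<in>U. x i) * (\<Prod>i\<in>tops p r U. C i i) / (\<Prod>i\<in>U. C i i ^ card {j \<in> N. p j = i})"
  proof -
    have "tops p r U = {i \<in> U. i \<in> tops p r U}" by (auto simp: tops_def)
    then have "(\<Prod>i\<in>U. if i \<in> tops p r U then C i i else 1) = (\<Prod>i\<in>tops p r U. C i i)"
      using prod.inter_filter[OF finU, of "\<lambda>i. C i i" "\<lambda>i. i \<in> tops p r U"] by simp
    then show ?thesis by (simp add: prod_dividef prod.distrib)
  qed
  also have "(\<Prod>i\<in>U. C i i ^ card {j \<in> N. p j = i}) = (\<Prod>j\<in>N. C (p j) (p j))"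
  proof -
    have "(\<Prod>j\<in>N. C (p j) (p j)) = (\<Prod>i\<in>U. \<Prod>j\<in>{j \<in> N. p j = i}. C (p j) (p j))"
      using finU by (intro prod.group[symmetric]) (auto simp: N)
    also have "\<dots> = (\<Prod>i\<in>U. C i i ^ card {j \<in> N. p j = i})"
      by (intro prod.cong refl) simp
    finally show ?thesis by simp
  qed
  finally show ?thesis
    by (simp add: edges forest_weight_def N_def[symmetric] prod_dividef)
qed

lemma tree_Phi_rec:
  assumes "finite V" "i \<in> V"
  shows "tree_Phi V E C r s i =
    s i * (\<Prod>j\<in>children V E r i. 1 + C i j / C i i * tree_Phi V E C r s j)"
  using assms by (subst tree_Phi.simps) simp

text \<open>The edge ratio is written in terms of the child alone, which is the shape of
  \<open>\<kappa>\<close> required by \<open>sum_forest_weight\<close>.\<close>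

lemma tree_Phi_parent_rec:
  assumes T: "tree_graph V E" and r: "r \<in> V" and i: "i \<in> V"
  shows "tree_Phi V E C r s i = s i * (\<Prod>j\<in>{j \<in> V. j \<noteq> r \<and> parent V E r j = i}.
    1 + C (parent V E r j) j / C (parent V E r j) (parent V E r j) * tree_Phi V E C r s j)"
proof -
  have "finite V" using T by (simp add: tree_graph_def)
  with i have "tree_Phi V E C r s i =
      s i * (\<Prod>j\<in>children V E r i. 1 + C i j / C i i * tree_Phi V E C r s j)"
    by (intro tree_Phi_rec)
  also have "(\<Prod>j\<in>children V E r i. 1 + C i j / C i i * tree_Phi V E C r s j) =
      (\<Prod>j\<in>{j \<in> V. j \<noteq> r \<and> parent V E r j = i}.
        1 + C (parent V E r j) j / C (parent V E r j) (parent V E r j) * tree_Phi V E C r s j)"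
    by (rule prod.cong) (auto simp: children_eq_parent_fibre[OF T r])
  finally show ?thesis .
qed

lemma sum_subtrees_eq:
  assumes T: "tree_graph V E" and r: "r \<in> V" and C: "C \<in> weight_matrices V E"
  shows "(\<Sum>(U, F)\<in>subtrees V E. (\<Prod>i\<in>U. s i / C i i powi (int (vertex_degree F i) - 1)) *
      (\<Prod>e\<in>F. edge_weight C e)) = (\<Sum>i\<in>V. C i i * tree_Phi V E C r s i)"
proof -
  let ?p = "parent V E r"
  \<comment> \<open>A subtree is determined by its vertex set, so the sum may run over one-top
    sets.\<close>
  have "(U, F) \<in> subtrees V E \<longleftrightarrow> U \<subseteq> V \<and> (\<exists>t. tops ?p r U = {t}) \<and> F = {e \<in> E. e \<subseteq> U}" for U F
    unfolding subtrees_def using tree_graph_induced_iff[OF T r, of U] by blast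
  then have "subtrees V E = (\<lambda>U. (U, {e \<in> E. e \<subseteq> U})) ` {U. U \<subseteq> V \<and> (\<exists>t. tops ?p r U = {t})}"
    by (intro set_eqI) (simp add: image_iff split_paired_all)
  then have reindex: "(\<Sum>(U, F)\<in>subtrees V E. g U F) =
      (\<Sum>U | U \<subseteq> V \<and> (\<exists>t. tops ?p r U = {t}). g U {e \<in> E. e \<subseteq> U})" for g :: "_ \<Rightarrow> _ \<Rightarrow> real"
    using sum.reindex[of "\<lambda>U. (U, {e \<in> E. e \<subseteq> U})"
        "{U. U \<subseteq> V \<and> (\<exists>t. tops ?p r U = {t})}" "\<lambda>(U, F). g U F"]
    by (simp add: inj_on_def)
  have "(\<Sum>(U, F)\<in>subtrees V E. (\<Prod>i\<in>U. s i / C i i powi (int (vertex_degree F i) - 1)) *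
      (\<Prod>e\<in>F. edge_weight C e)) = (\<Sum>U | U \<subseteq> V \<and> (\<exists>t. tops ?p r U = {t}).
      forest_weight ?p r (\<lambda>i. C i i) (\<lambda>j. C (?p j) j / C (?p j) (?p j)) s U)"
    unfolding reindex by (rule sum.cong[OF refl], rule subtree_weight_eq[OF T r _ C]) simp
  also have "\<dots> = (\<Sum>i\<in>V. C i i * tree_Phi V E C r s i)"
  proof (rule sum_forest_weight[where d = "graph_dist V E r"])
    show "finite V" using T by (simp add: tree_graph_def)
    show "graph_dist V E r (?p j) < graph_dist V E r j" if "j \<in> V" "j \<noteq> r" for j
      using child_of_parent(1)[OF T r that] by (simp add: children_def)
  qed (rule tree_Phi_parent_rec[OF T r])
  finally show ?thesis .
qed

section \<open>Triangular substitutions and product densities\<close>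

lemma measurable_PiM_lborel_component:
  "i \<in> V \<Longrightarrow> (\<lambda>x. x i :: real) \<in> borel_measurable (PiM V (\<lambda>_. lborel))"
  using measurable_component_singleton[of i V "\<lambda>_. lborel :: real measure"] by simp

lemma measurable_PiM_rescale_coordinate:
  fixes q :: "('v \<Rightarrow> real) \<Rightarrow> real"
  assumes v: "v \<in> V" and q: "q \<in> borel_measurable (PiM V (\<lambda>_. lborel))"
  shows "(\<lambda>x. x(v := x v / q x)) \<in> PiM V (\<lambda>_. lborel) \<rightarrow>\<^sub>M PiM V (\<lambda>_. lborel)"
proof (rule measurable_PiM_single')
  show "(\<lambda>x. (x(v := x v / q x)) i) \<in> PiM V (\<lambda>_. lborel) \<rightarrow>\<^sub>M lborel" if "i \<in> V" for i
    using measurable_PiM_lborel_component[OF that]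
      borel_measurable_divide[OF measurable_PiM_lborel_component[OF v] q]
    by (cases "i = v") simp_all
  show "(\<lambda>x. x(v := x v / q x)) \<in> space (PiM V (\<lambda>_. lborel)) \<rightarrow> (\<Pi>\<^sub>E i\<in>V. space lborel)"
    using v by (auto simp: space_PiM PiE_def extensional_def)
qed

text \<open>Integrating over coordinate \<open>v\<close> innermost, \<open>q\<close> is a constant
  because it ignores that coordinate, and a one-dimensional linear substitution supplies the factor
  \<open>1 / q x\<close>.\<close>

lemma nn_integral_PiM_rescale_coordinate:
  fixes q :: "('v \<Rightarrow> real) \<Rightarrow> real"
  assumes V: "finite V" "v \<in> V"
    and [measurable]: "F \<in> borel_measurable (PiM V (\<lambda>_. lborel))"
    and [measurable]: "q \<in> borel_measurable (PiM V (\<lambda>_. lborel))"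
    and pos: "\<And>x. 0 < q x" and indep: "\<And>x t. q (x(v := t)) = q x"
  shows "(\<integral>\<^sup>+x. F x \<partial>PiM V (\<lambda>_. lborel)) =
    (\<integral>\<^sup>+x. F (x(v := x v / q x)) * ennreal (1 / q x) \<partial>PiM V (\<lambda>_. lborel))"
proof -
  interpret product_sigma_finite "\<lambda>_::'v. lborel :: real measure"
    by standard
  define I where "I = V - {v}"
  have I: "finite I" "v \<notin> I" "V = insert v I" using V by (auto simp: I_def)
  note [measurable] = measurable_PiM_rescale_coordinate[OF V(2) assms(4)]
  have meas_upd: "(\<lambda>y. x(v := y)) \<in> lborel \<rightarrow>\<^sub>M PiM V (\<lambda>_. lborel)"
    if "x \<in> space (PiM I (\<lambda>_. lborel))" for x
    unfolding I(3) using that measurable_add_dim[of v I "\<lambda>_. lborel"]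
    by (auto intro: measurable_compose[OF measurable_Pair1'[OF that]])
  have "(\<integral>\<^sup>+x. F x \<partial>PiM V (\<lambda>_. lborel)) = (\<integral>\<^sup>+x. \<integral>\<^sup>+y. F (x(v := y)) \<partial>lborel \<partial>PiM I (\<lambda>_. lborel))"
    using assms(3) unfolding I(3) by (rule product_nn_integral_insert[OF I(1,2)])
  also have "\<dots> = (\<integral>\<^sup>+x. \<integral>\<^sup>+y. F (x(v := y / q x)) * ennreal (1 / q x) \<partial>lborel \<partial>PiM I (\<lambda>_. lborel))"
  proof (rule nn_integral_cong)
    fix x assume x: "x \<in> space (PiM I (\<lambda>_. lborel :: real measure))"
    have [measurable]: "(\<lambda>y. F (x(v := y))) \<in> borel_measurable borel"
      using measurable_compose[OF meas_upd[OF x] assms(3)] by simp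
    have "(\<integral>\<^sup>+y. F (x(v := y)) \<partial>lborel) =
        ennreal \<bar>1 / q x\<bar> * (\<integral>\<^sup>+y. F (x(v := 0 + 1 / q x * y)) \<partial>lborel)"
      using pos[of x] by (intro nn_integral_real_affine) auto
    also have "\<dots> = (\<integral>\<^sup>+y. F (x(v := y / q x)) * ennreal (1 / q x) \<partial>lborel)"
    proof -
      have "(\<lambda>y. F (x(v := y / q x))) = (\<lambda>y. F (x(v := y))) \<circ> (\<lambda>y. y / q x)" by auto
      then have "(\<lambda>y. F (x(v := y / q x))) \<in> borel_measurable lborel" by simp
      from nn_integral_cmult[OF this, of "ennreal (1 / q x)"] show ?thesis
        using pos[of x] by (simp add: mult.commute)
    qed
    finally show "(\<integral>\<^sup>+y. F (x(v := y)) \<partial>lborel) =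
      (\<integral>\<^sup>+y. F (x(v := y / q x)) * ennreal (1 / q x) \<partial>lborel)" .
  qed
  also have "\<dots> = (\<integral>\<^sup>+x. F (x(v := x v / q x)) * ennreal (1 / q x) \<partial>PiM V (\<lambda>_. lborel))"
  proof -
    have "(\<lambda>x. F (x(v := x v / q x)) * ennreal (1 / q x)) \<in> borel_measurable (PiM V (\<lambda>_. lborel))"
      by measurable
    then show ?thesis
      unfolding I(3) by (subst product_nn_integral_insert[OF I(1,2)]) (simp_all add: indep)
  qed
  finally show ?thesis .
qed

text \<open>The coordinates are rescaled one at a time in order of increasing \<open>d\<close>, so that each step
  only uses coordinates that are still untouched.\<close>

lemma nn_integral_PiM_triangular:
  fixes d :: "'v \<Rightarrow> nat" and q :: "'v \<Rightarrow> ('v \<Rightarrow> real) \<Rightarrow> real"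
  assumes V: "finite V"
    and q [measurable]: "\<And>i. i \<in> V \<Longrightarrow> q i \<in> borel_measurable (PiM V (\<lambda>_. lborel))"
    and pos: "\<And>i x. 0 < q i x"
    and dep: "\<And>i x y. i \<in> V \<Longrightarrow> (\<And>j. j \<in> V \<Longrightarrow> d i < d j \<Longrightarrow> x j = y j) \<Longrightarrow> q i x = q i y"
    and F: "F \<in> borel_measurable (PiM V (\<lambda>_. lborel))"
  shows "(\<integral>\<^sup>+x. F x \<partial>PiM V (\<lambda>_. lborel)) =
    (\<integral>\<^sup>+x. F (\<lambda>i. if i \<in> V then x i / q i x else x i) * (\<Prod>i\<in>V. ennreal (1 / q i x))
      \<partial>PiM V (\<lambda>_. lborel))"
proof -
  let ?P = "PiM V (\<lambda>_. lborel :: real measure)"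
  have "(\<integral>\<^sup>+x. F x \<partial>?P) = (\<integral>\<^sup>+x. F (\<lambda>i. if i \<in> A then x i / q i x else x i) *
      (\<Prod>i\<in>A. ennreal (1 / q i x)) \<partial>?P)" if "A \<subseteq> V" for A
  proof -
    have "finite A" using that V finite_subset by blast
    then show ?thesis
      using that F
    proof (induction A arbitrary: F rule: finite_ranking_induct[where f = d])
      case empty
      then show ?case by simp
    next
      case (insert v A)
      show ?case
      proof (cases "v \<in> A")
        case True
        with insert show ?thesis by (simp add: insert_absorb)
      next
        case False
        let ?\<Psi> = "\<lambda>x i. if i \<in> A then x i / q i x else x i"
        note [measurable] = insert.prems(2) q[of v]
        have v: "v \<in> V" "A \<subseteq> V" using insert.prems by auto
        note [measurable] = measurable_PiM_rescale_coordinate[OF v(1) q[OF v(1)]]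
        have "(\<integral>\<^sup>+x. F x \<partial>?P) = (\<integral>\<^sup>+x. F (x(v := x v / q v x)) * ennreal (1 / q v x) \<partial>?P)"
          using v by (intro nn_integral_PiM_rescale_coordinate V insert.prems q pos dep) auto
        also have "\<dots> = (\<integral>\<^sup>+x. (F ((?\<Psi> x)(v := ?\<Psi> x v / q v (?\<Psi> x))) * ennreal (1 / q v (?\<Psi> x))) *
            (\<Prod>i\<in>A. ennreal (1 / q i x)) \<partial>?P)"
          using v q[of v] by (intro insert.IH) measurable
        also have "\<dots> = (\<integral>\<^sup>+x. F (\<lambda>i. if i \<in> insert v A then x i / q i x else x i) *
            (\<Prod>i\<in>insert v A. ennreal (1 / q i x)) \<partial>?P)"
        proof (rule nn_integral_cong)
          fix x
          \<comment> \<open>The factor \<open>q v\<close> reads only coordinates with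
            \<open>d\<close> above \<open>d v\<close>; none of these is in \<open>A\<close>, so
            rescaling on \<open>A\<close> does not affect it.\<close>
          have "q v (?\<Psi> x) = q v x" using insert.hyps(2) v by (intro dep) force+
          moreover have "(?\<Psi> x)(v := ?\<Psi> x v / q v x) =
              (\<lambda>i. if i \<in> insert v A then x i / q i x else x i)"
            using False by (auto simp: fun_eq_iff)
          ultimately show "F ((?\<Psi> x)(v := ?\<Psi> x v / q v (?\<Psi> x))) * ennreal (1 / q v (?\<Psi> x)) *
              (\<Prod>i\<in>A. ennreal (1 / q i x)) =
              F (\<lambda>i. if i \<in> insert v A then x i / q i x else x i) * (\<Prod>i\<in>insert v A. ennreal (1 / q i x))"
            using False insert.hyps(1) by (simp add: mult.assoc)
        qed
        finally show ?thesis .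
      qed
    qed
  qed
  from this[OF subset_refl] show ?thesis .
qed

text \<open>Testing against a set \<open>A\<close> and substituting \<open>\<Psi>\<close> turns the
  indicator at \<open>\<Phi> (\<Psi> x)\<close> into the one at \<open>x\<close>. The inversion is
  asked for only where the density is nonzero, which leaves freedom to choose \<open>q\<close> off
  the support.\<close>

lemma distributed_triangular:
  fixes d :: "'v \<Rightarrow> nat" and q :: "'v \<Rightarrow> ('v \<Rightarrow> real) \<Rightarrow> real"
    and V :: "'v set"
  defines "\<Psi> \<equiv> \<lambda>x i. if i \<in> V then x i / q i x else x i"
  assumes V: "finite V"
    and q [measurable]: "\<And>i. i \<in> V \<Longrightarrow> q i \<in> borel_measurable (PiM V (\<lambda>_. lborel))"
    and pos: "\<And>i x. 0 < q i x"
    and dep: "\<And>i x y. i \<in> V \<Longrightarrow> (\<And>j. j \<in> V \<Longrightarrow> d i < d j \<Longrightarrow> x j = y j) \<Longrightarrow> q i x = q i y"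
    and S: "distributed M (PiM V (\<lambda>_. lborel)) S f"
    and \<Phi> [measurable]: "\<Phi> \<in> PiM V (\<lambda>_. lborel) \<rightarrow>\<^sub>M PiM V (\<lambda>_. lborel)"
    and inv: "\<And>x. x \<in> space (PiM V (\<lambda>_. lborel)) \<Longrightarrow> f (\<Psi> x) \<noteq> 0 \<Longrightarrow> \<Phi> (\<Psi> x) = x"
  shows "distributed M (PiM V (\<lambda>_. lborel)) (\<lambda>\<omega>. \<Phi> (S \<omega>))
    (\<lambda>x. f (\<Psi> x) * (\<Prod>i\<in>V. ennreal (1 / q i x)))"
proof -
  let ?P = "PiM V (\<lambda>_. lborel :: real measure)"
  have f [measurable]: "f \<in> borel_measurable ?P" and S_meas [measurable]: "S \<in> M \<rightarrow>\<^sub>M ?P"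
    using S by (auto simp: distributed_def)
  have \<Psi> [measurable]: "\<Psi> \<in> ?P \<rightarrow>\<^sub>M ?P"
    unfolding \<Psi>_def
  proof (rule measurable_PiM_single')
    show "(\<lambda>x. if i \<in> V then x i / q i x else x i) \<in> ?P \<rightarrow>\<^sub>M lborel" if "i \<in> V" for i
      using that q[of i] by simp
    show "(\<lambda>x i. if i \<in> V then x i / q i x else x i) \<in> space ?P \<rightarrow> (\<Pi>\<^sub>E i\<in>V. space lborel)"
      by (auto simp: space_PiM PiE_def extensional_def)
  qed
  have g [measurable]: "(\<lambda>x. f (\<Psi> x) * (\<Prod>i\<in>V. ennreal (1 / q i x))) \<in> borel_measurable ?P"
    by (intro borel_measurable_times_ennreal borel_measurable_prod_ennreal) (use q in measurable)
  have "distr M ?P (\<lambda>\<omega>. \<Phi> (S \<omega>)) = distr (distr M ?P S) ?P \<Phi>"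
    by (simp add: distr_distr comp_def)
  also have "\<dots> = distr (density ?P f) ?P \<Phi>"
    using S by (simp add: distributed_def)
  also have "\<dots> = density ?P (\<lambda>x. f (\<Psi> x) * (\<Prod>i\<in>V. ennreal (1 / q i x)))"
  proof (rule measure_eqI)
    fix A assume "A \<in> sets (distr (density ?P f) ?P \<Phi>)"
    then have A [measurable]: "A \<in> sets ?P" by simp
    have "emeasure (distr (density ?P f) ?P \<Phi>) A = (\<integral>\<^sup>+x. f x * indicator A (\<Phi> x) \<partial>?P)"
      by (subst emeasure_distr)
        (auto simp: emeasure_density simp flip: indicator_vimage
          intro!: nn_integral_cong split: split_indicator)
    also have "\<dots> = (\<integral>\<^sup>+x. f (\<Psi> x) * indicator A (\<Phi> (\<Psi> x)) *
        (\<Prod>i\<in>V. ennreal (1 / q i x)) \<partial>?P)"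
      unfolding \<Psi>_def by (rule nn_integral_PiM_triangular[OF V q pos dep]) auto
    also have "\<dots> = (\<integral>\<^sup>+x. f (\<Psi> x) * (\<Prod>i\<in>V. ennreal (1 / q i x)) * indicator A x \<partial>?P)"
    proof (rule nn_integral_cong)
      fix x assume "x \<in> space ?P"
      from inv[OF this] show "f (\<Psi> x) * indicator A (\<Phi> (\<Psi> x)) * (\<Prod>i\<in>V. ennreal (1 / q i x)) =
          f (\<Psi> x) * (\<Prod>i\<in>V. ennreal (1 / q i x)) * indicator A x"
        by (cases "f (\<Psi> x) = 0") (simp_all add: mult_ac)
    qed
    also have "\<dots> = emeasure (density ?P (\<lambda>x. f (\<Psi> x) * (\<Prod>i\<in>V. ennreal (1 / q i x)))) A"
      by (simp add: emeasure_density)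
    finally show "emeasure (distr (density ?P f) ?P \<Phi>) A =
      emeasure (density ?P (\<lambda>x. f (\<Psi> x) * (\<Prod>i\<in>V. ennreal (1 / q i x)))) A" .
  qed simp
  finally show ?thesis
    by (simp add: distributed_def)
qed

section \<open>Independence and marginals from a product density\<close>

text \<open>Integrals over boxes factorise. Normalising every factor to a probability density
  identifies the joint law as a product measure, from which independence and the marginals are read
  off.\<close>

lemma (in prob_space) product_density_indep:
  fixes h :: "'v \<Rightarrow> real \<Rightarrow> ennreal" and K :: real
  assumes V: "finite V" "V \<noteq> {}"
    and h [measurable]: "\<And>i. i \<in> V \<Longrightarrow> h i \<in> borel_measurable borel"
    and X: "distributed M (PiM V (\<lambda>_. lborel)) X (\<lambda>x. ennreal K * (\<Prod>i\<in>V. h i (x i)))"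
  shows "indep_vars (\<lambda>_. borel) (\<lambda>i \<omega>. X \<omega> i) V"
    and "i \<in> V \<Longrightarrow> \<exists>k>0. distributed M lborel (\<lambda>\<omega>. X \<omega> i) (\<lambda>x. ennreal k * h i x)"
proof -
  let ?P = "PiM V (\<lambda>_. lborel :: real measure)"
  interpret L: product_sigma_finite "\<lambda>_::'v. lborel :: real measure" by standard
  have X_meas [measurable]: "X \<in> M \<rightarrow>\<^sub>M ?P"
    and distr_X: "distr M ?P X = density ?P (\<lambda>x. ennreal K * (\<Prod>i\<in>V. h i (x i)))"
    using X by (auto simp: distributed_def)
  have h' [measurable]: "h i \<in> borel_measurable lborel" if "i \<in> V" for i using h[OF that] by simp
  define J where "J = (\<lambda>i. \<integral>\<^sup>+x. h i x \<partial>lborel)"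
  have box: "(\<integral>\<^sup>+x. ennreal K * (\<Prod>i\<in>V. h i (x i)) * indicator (Pi\<^sub>E V A) x \<partial>?P) =
      ennreal K * (\<Prod>i\<in>V. \<integral>\<^sup>+x. h i x * indicator (A i) x \<partial>lborel)"
    if A: "\<And>i. i \<in> V \<Longrightarrow> A i \<in> sets borel" for A
  proof -
    note [measurable] = A
    have "(\<integral>\<^sup>+x. ennreal K * (\<Prod>i\<in>V. h i (x i)) * indicator (Pi\<^sub>E V A) x \<partial>?P) =
        (\<integral>\<^sup>+x. ennreal K * (\<Prod>i\<in>V. h i (x i) * indicator (A i) (x i)) \<partial>?P)"
    proof (rule nn_integral_cong)
      fix x assume "x \<in> space ?P"
      then have "indicator (Pi\<^sub>E V A) x = (\<Prod>i\<in>V. indicator (A i) (x i) :: ennreal)"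
        using V by (auto simp: indicator_def space_PiM PiE_def Pi_def prod_zero_iff)
      then show "ennreal K * (\<Prod>i\<in>V. h i (x i)) * indicator (Pi\<^sub>E V A) x =
          ennreal K * (\<Prod>i\<in>V. h i (x i) * indicator (A i) (x i))"
        by (simp add: prod.distrib mult.assoc)
    qed
    also have "\<dots> = ennreal K * (\<integral>\<^sup>+x. (\<Prod>i\<in>V. h i (x i) * indicator (A i) (x i)) \<partial>?P)"
      by (intro nn_integral_cmult borel_measurable_prod_ennreal) measurable
    also have "(\<integral>\<^sup>+x. (\<Prod>i\<in>V. h i (x i) * indicator (A i) (x i)) \<partial>?P) =
        (\<Prod>i\<in>V. \<integral>\<^sup>+x. h i x * indicator (A i) x \<partial>lborel)"
      by (intro L.product_nn_integral_prod[OF V(1)]) measurable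
    finally show ?thesis .
  qed
  have "1 = emeasure (distr M ?P X) (space ?P)"
    using prob_space.emeasure_space_1[OF prob_space_distr[OF X_meas]] by simp
  also have "\<dots> = (\<integral>\<^sup>+x. ennreal K * (\<Prod>i\<in>V. h i (x i)) * indicator (Pi\<^sub>E V (\<lambda>_. UNIV)) x \<partial>?P)"
  proof -
    have "(\<lambda>x. ennreal K * (\<Prod>i\<in>V. h i (x i))) \<in> borel_measurable ?P"
      using X by (simp add: distributed_def)
    then show ?thesis unfolding distr_X
      by (subst emeasure_density) (simp_all add: space_PiM sets.top[of ?P, unfolded space_PiM, simplified])
  qed
  also have "\<dots> = ennreal K * (\<Prod>i\<in>V. J i)"
    by (subst box) (simp_all add: J_def)
  finally have total: "ennreal K * (\<Prod>i\<in>V. J i) = 1" by simp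
  \<comment> \<open>Total mass one excludes a zero factor; with all factors nonzero, an infinite one
    would make the product infinite.\<close>
  have J0: "J i \<noteq> 0" if "i \<in> V" for i
    using total prod_zero[OF V(1), of J] that by fastforce
  have Jtop: "J i \<noteq> \<top>" if "i \<in> V" for i
  proof
    assume "J i = \<top>"
    with J0 that V have "(\<Prod>i\<in>V. J i) = \<top>" by (auto simp: ennreal_prod_eq_top)
    with total show False by (simp add: ennreal_mult_top split: if_splits)
  qed
  define k where "k = (\<lambda>i. 1 / enn2real (J i))"
  have J_eq: "J i = ennreal (1 / k i)" and k_pos: "0 < k i" if "i \<in> V" for i
  proof -
    show "J i = ennreal (1 / k i)" using Jtop[OF that] by (simp add: k_def ennreal_enn2real_if)
    show "0 < k i" using Jtop[OF that] J0[OF that]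
      by (simp add: k_def enn2real_positive_iff less_top zero_less_iff_neq_zero)
  qed
  have "(\<Prod>i\<in>V. J i) = ennreal (\<Prod>i\<in>V. 1 / k i)"
    using J_eq k_pos by (simp add: prod_ennreal less_imp_le)
  with total have "ennreal (K * (\<Prod>i\<in>V. 1 / k i)) = 1"
    using k_pos by (simp add: ennreal_mult'' prod_nonneg less_imp_le)
  then have "K * (\<Prod>i\<in>V. 1 / k i) = 1" by (simp add: ennreal_eq_1)
  moreover have "(\<Prod>i\<in>V. k i) > 0" using k_pos by (intro prod_pos) auto
  ultimately have K: "K = (\<Prod>i\<in>V. k i)" by (simp add: prod_dividef divide_simps)
  \<comment> \<open>A product family needs a measure at every index, so a point mass at 0 fills the
    indices outside \<open>V\<close> and every \<open>N i\<close> is a probability measure.\<close>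
  define N where "N = (\<lambda>i. if i \<in> V then density lborel (\<lambda>x. ennreal (k i) * h i x) else return borel 0)"
  have sets_N [simp, measurable_cong]: "sets (N i) = sets borel" for i by (simp add: N_def)
  have N_emeasure: "emeasure (N i) A = ennreal (k i) * (\<integral>\<^sup>+x. h i x * indicator A x \<partial>lborel)"
    if "i \<in> V" "A \<in> sets borel" for i A
    using that h'[OF that(1)] by (simp add: N_def emeasure_density mult.assoc nn_integral_cmult)
  have N_prob: "prob_space (N i)" for i
  proof (cases "i \<in> V")
    case True
    have "space (N i) = UNIV" using sets_eq_imp_space_eq[OF sets_N] by simp
    then have "emeasure (N i) (space (N i)) = ennreal (k i) * J i"
      using N_emeasure[OF True, of UNIV] by (simp add: J_def)
    also have "\<dots> = 1"
      using J_eq[OF True] k_pos[OF True] by (simp flip: ennreal_mult)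
    finally show ?thesis by (rule prob_spaceI)
  qed (simp add: N_def prob_space_return)
  interpret N: product_sigma_finite N
    by (rule product_sigma_finite.intro) (rule prob_space_imp_sigma_finite[OF N_prob])
  have sets_P: "sets ?P = sets (PiM V N)" by (rule sets_PiM_cong) auto
  have distr_X_eq: "distr M ?P X = PiM V N"
  proof (rule N.PiM_eqI[OF V(1)])
    show "sets (distr M ?P X) = sets (PiM V N)" by (simp add: sets_P)
    fix A assume "\<And>i. i \<in> V \<Longrightarrow> A i \<in> sets (N i)"
    then have A: "\<And>i. i \<in> V \<Longrightarrow> A i \<in> sets borel" by simp
    have m: "(\<lambda>x. ennreal K * (\<Prod>i\<in>V. h i (x i))) \<in> borel_measurable ?P"
      using X by (simp add: distributed_def)
    have "Pi\<^sub>E V A \<in> sets ?P" using A V by (intro sets_PiM_I_finite) auto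
    with m have "emeasure (distr M ?P X) (Pi\<^sub>E V A) =
        ennreal K * (\<Prod>i\<in>V. \<integral>\<^sup>+x. h i x * indicator (A i) x \<partial>lborel)"
      unfolding distr_X by (simp add: emeasure_density box[OF A])
    also have "\<dots> = (\<Prod>i\<in>V. emeasure (N i) (A i))"
      using A k_pos by (simp add: N_emeasure K prod.distrib prod_ennreal less_imp_le)
    finally show "emeasure (distr M ?P X) (Pi\<^sub>E V A) = (\<Prod>i\<in>V. emeasure (N i) (A i))" .
  qed
  have X_i [measurable]: "(\<lambda>\<omega>. X \<omega> i) \<in> borel_measurable M" if "i \<in> V" for i
    using measurable_compose[OF X_meas measurable_component_singleton[OF that]] by simp
  have marginal: "distr M borel (\<lambda>\<omega>. X \<omega> i) = N i" if i: "i \<in> V" for i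
  proof -
    have "distr M borel (\<lambda>\<omega>. X \<omega> i) = distr (distr M ?P X) borel (\<lambda>x. x i)"
      using i by (subst distr_distr) (auto simp: comp_def)
    also have "\<dots> = distr (PiM V N) (N i) (\<lambda>x. x i)"
      unfolding distr_X_eq by (intro distr_cong) auto
    also have "\<dots> = N i" using N_prob i by (intro distr_PiM_component)
    finally show ?thesis .
  qed
  show "indep_vars (\<lambda>_. borel) (\<lambda>i \<omega>. X \<omega> i) V"
  proof (subst indep_vars_iff_distr_eq_PiM'[OF V(2)])
    have "(\<lambda>\<omega>. \<lambda>i\<in>V. X \<omega> i) \<omega> = X \<omega>" if "\<omega> \<in> space M" for \<omega>
      using measurable_space[OF X_meas that] by (auto simp: space_PiM PiE_def extensional_restrict)
    then have "distr M (PiM V (\<lambda>_. borel)) (\<lambda>\<omega>. \<lambda>i\<in>V. X \<omega> i) = distr M ?P X"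
      by (intro distr_cong sets_PiM_cong) auto
    also have "\<dots> = PiM V (\<lambda>i. distr M borel (\<lambda>\<omega>. X \<omega> i))"
      unfolding distr_X_eq by (intro PiM_cong) (auto simp: marginal)
    finally show "distr M (PiM V (\<lambda>_. borel)) (\<lambda>\<omega>. \<lambda>i\<in>V. X \<omega> i) =
      PiM V (\<lambda>i. distr M borel (\<lambda>\<omega>. X \<omega> i))" .
  qed (rule X_i)
  show "\<exists>k>0. distributed M lborel (\<lambda>\<omega>. X \<omega> i) (\<lambda>x. ennreal k * h i x)" if i: "i \<in> V"
  proof (intro exI conjI)
    have "distr M lborel (\<lambda>\<omega>. X \<omega> i) = distr M borel (\<lambda>\<omega>. X \<omega> i)" by (intro distr_cong) auto
    with marginal[OF i] i show "distributed M lborel (\<lambda>\<omega>. X \<omega> i) (\<lambda>x. ennreal (k i) * h i x)"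
      using h[OF i] by (simp add: distributed_def N_def)
  qed (rule k_pos[OF i])
qed

section \<open>The density of the transformed vector\<close>

text \<open>Induction from the leaves towards the root, on the same measure that makes
  \<open>tree_Phi\<close> terminate.\<close>

lemma induct_children:
  assumes "finite V" "i \<in> V"
    and step: "\<And>i. i \<in> V \<Longrightarrow> (\<And>j. j \<in> children V E r i \<Longrightarrow> P j) \<Longrightarrow> P i"
  shows "P i"
  using \<open>i \<in> V\<close>
proof (induction i rule: measure_induct_rule[of "\<lambda>i. Max (graph_dist V E r ` V) - graph_dist V E r i"])
  case (less i)
  show ?case
  proof (rule step[OF less.prems])
    fix j assume j: "j \<in> children V E r i"
    then have "graph_dist V E r j \<le> Max (graph_dist V E r ` V)"
      using \<open>finite V\<close> by (intro Max_ge) (auto simp: children_def)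
    with j show "P j" by (intro less.IH) (auto simp: children_def)
  qed
qed

lemma measurable_tree_Phi:
  assumes V: "finite V"
  shows "tree_Phi V E C r \<in> PiM V (\<lambda>_. lborel) \<rightarrow>\<^sub>M PiM V (\<lambda>_. lborel)"
proof -
  have "(\<lambda>s. \<lambda>i. tree_Phi V E C r s i) \<in> PiM V (\<lambda>_. lborel) \<rightarrow>\<^sub>M PiM V (\<lambda>_. lborel)"
  proof (rule measurable_PiM_single')
    show "(\<lambda>s. tree_Phi V E C r s i) \<in> PiM V (\<lambda>_. lborel) \<rightarrow>\<^sub>M lborel" if "i \<in> V" for i
      using V that
    proof (induction i rule: induct_children[where E = E and r = r, consumes 2])
      case (1 i)
      have "(\<lambda>s. s i * (\<Prod>j\<in>children V E r i. 1 + C i j / C i i * tree_Phi V E C r s j))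
          \<in> borel_measurable (PiM V (\<lambda>_. lborel))"
        using 1 by (intro borel_measurable_times borel_measurable_prod borel_measurable_add
            borel_measurable_const measurable_PiM_lborel_component) simp_all
      then show ?case using tree_Phi_rec[OF V 1(1)] by simp
    qed
    show "(\<lambda>s i. tree_Phi V E C r s i) \<in> space (PiM V (\<lambda>_. lborel)) \<rightarrow> (\<Pi>\<^sub>E i\<in>V. space lborel)"
      by (auto simp: PiE_def extensional_def tree_Phi.simps)
  qed
  then show ?thesis .
qed

text \<open>Truncating at \<open>0\<close> makes the factor positive for all \<open>x\<close>; the densities vanish off the positive
  orthant, so the values there are irrelevant.\<close>

definition child_factor ::
  "'v set \<Rightarrow> 'v set set \<Rightarrow> ('v \<Rightarrow> 'v \<Rightarrow> real) \<Rightarrow> 'v \<Rightarrow> 'v \<Rightarrow> ('v \<Rightarrow> real) \<Rightarrow> real" where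
  "child_factor V E C r i x = (\<Prod>j\<in>children V E r i. 1 + C i j / C i i * max 0 (x j))"

lemma child_factor_pos:
  assumes T: "tree_graph V E" and C: "C \<in> weight_matrices V E"
  shows "0 < child_factor V E C r i x"
  unfolding child_factor_def
proof (rule prod_pos)
  fix j assume "j \<in> children V E r i"
  then have "{i, j} \<in> E" by (simp add: children_def)
  with tree_edgeD[OF T this] C have "0 < C i j" "0 < C i i" by (auto simp: weight_matrices_def)
  then show "0 < 1 + C i j / C i i * max 0 (x j)"
    by (intro add_pos_nonneg mult_nonneg_nonneg) auto
qed

text \<open>Once the children return \<open>x j\<close>, the product in the recursion equals
  \<open>child_factor\<close>, which cancels the divisor. Positivity of \<open>x\<close> makes the
  truncation inactive.\<close>

lemma tree_Phi_left_inverse: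
  assumes T: "tree_graph V E" and C: "C \<in> weight_matrices V E"
    and pos: "\<And>i. i \<in> V \<Longrightarrow> 0 < x i" and i: "i \<in> V"
  shows "tree_Phi V E C r (\<lambda>i. if i \<in> V then x i / child_factor V E C r i x else x i) i = x i"
proof -
  have V: "finite V" using T by (simp add: tree_graph_def)
  show ?thesis
    using V i
  proof (induction i rule: induct_children[where E = E and r = r, consumes 2])
    case (1 i)
    have "(\<Prod>j\<in>children V E r i. 1 + C i j / C i i *
        tree_Phi V E C r (\<lambda>i. if i \<in> V then x i / child_factor V E C r i x else x i) j) =
        child_factor V E C r i x"
      unfolding child_factor_def[of _ _ _ _ i] using 1(2) pos
      by (intro prod.cong) (auto simp: children_def max_def not_le less_imp_le)
    then show ?case
      using 1(1) child_factor_pos[OF T C, of r i x] by (simp add: tree_Phi_rec[OF V])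
  qed
qed

section \<open>The factorised density\<close>

text \<open>The unnormalised density of one coordinate. The exponent \<open>- a p\<close> combines
  \<open>- (a p - 1)\<close> from the power of the original coordinate at \<open>p\<close> with
  \<open>- 1\<close> from the Jacobian.\<close>

definition factor_density ::
  "'v set \<Rightarrow> 'v set set \<Rightarrow> ('v \<Rightarrow> real) \<Rightarrow> ('v \<Rightarrow> 'v \<Rightarrow> real) \<Rightarrow> 'v \<Rightarrow> 'v \<Rightarrow> real \<Rightarrow> real" where
  "factor_density V E a C r i t = t powr (a i - 1) * exp (- C i i * t) *
     (if i = r then 1 else let p = parent V E r i in (1 + C p i / C p p * t) powr - a p) *
     indicator {0<..} t"

text \<open>The double product over vertices and children is regrouped along the parent map; only
  the root lacks a factor.\<close>

lemma prod_child_factor_powr: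
  assumes T: "tree_graph V E" and r: "r \<in> V" and C: "C \<in> weight_matrices V E"
    and pos: "\<And>i. i \<in> V \<Longrightarrow> 0 < x i"
  shows "(\<Prod>i\<in>V. child_factor V E C r i x powr - a i) =
    (\<Prod>i\<in>V. if i = r then 1 else let p = parent V E r i in (1 + C p i / C p p * x i) powr - a p)"
proof -
  let ?p = "parent V E r"
  define g where "g = (\<lambda>i j. (1 + C i j / C i i * x j) powr - a i)"
  have V: "finite V" using T by (simp add: tree_graph_def)
  have "(\<Prod>i\<in>V. child_factor V E C r i x powr - a i) = (\<Prod>i\<in>V. \<Prod>j\<in>children V E r i. g i j)"
  proof (rule prod.cong[OF refl])
    fix i assume i: "i \<in> V"
    have "child_factor V E C r i x powr - a i =
        (\<Prod>j\<in>children V E r i. (1 + C i j / C i i * max 0 (x j)) powr - a i)"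
      unfolding child_factor_def by (rule prod_powr_distrib)
    also have "\<dots> = (\<Prod>j\<in>children V E r i. g i j)"
      unfolding g_def using pos by (intro prod.cong) (auto simp: children_def max_def not_le less_imp_le)
    finally show "child_factor V E C r i x powr - a i = (\<Prod>j\<in>children V E r i. g i j)" .
  qed
  also have "\<dots> = (\<Prod>i\<in>V. \<Prod>j\<in>{j \<in> V - {r}. ?p j = i}. g (?p j) j)"
    by (intro prod.cong) (auto simp: children_eq_parent_fibre[OF T r])
  also have "\<dots> = (\<Prod>j\<in>V - {r}. g (?p j) j)"
    using V child_of_parent(2)[OF T r] by (intro prod.group) auto
  also have "\<dots> = (\<Prod>j\<in>V. if j = r then 1 else g (?p j) j)"
    using V r by (subst (2) prod.remove[of _ r]) (auto intro!: prod.cong)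
  finally show ?thesis by (simp only: g_def Let_def)
qed

lemma tree_Kummer_kernel_factor:
  assumes T: "tree_graph V E" and r: "r \<in> V" and C: "C \<in> weight_matrices V E"
  defines "q \<equiv> child_factor V E C r"
  shows "tree_Kummer_kernel V E a C (\<lambda>i. if i \<in> V then x i / q i x else x i) * (\<Prod>i\<in>V. 1 / q i x) =
    (\<Prod>i\<in>V. factor_density V E a C r i (x i))"
proof -
  let ?\<Psi> = "\<lambda>i. if i \<in> V then x i / q i x else x i"
  have V: "finite V" using T by (simp add: tree_graph_def)
  have qpos: "0 < q i x" for i unfolding q_def by (rule child_factor_pos[OF T C])
  show ?thesis
  proof (cases "\<forall>i\<in>V. 0 < x i")
    case True
    then have pos: "0 < x i" if "i \<in> V" for i using that by blast
    let ?e = "exp (- (\<Sum>i\<in>V. C i i * x i))"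
    have "tree_Kummer_kernel V E a C ?\<Psi> = (\<Prod>i\<in>V. (x i / q i x) powr (a i - 1)) *
        exp (- (\<Sum>i\<in>V. C i i * tree_Phi V E C r ?\<Psi> i))"
      unfolding tree_Kummer_kernel_def sum_subtrees_eq[OF T r C] using pos qpos by simp
    also have "(\<Sum>i\<in>V. C i i * tree_Phi V E C r ?\<Psi> i) = (\<Sum>i\<in>V. C i i * x i)"
      unfolding q_def using tree_Phi_left_inverse[OF T C, of x] pos by (intro sum.cong) auto
    finally have "tree_Kummer_kernel V E a C ?\<Psi> * (\<Prod>i\<in>V. 1 / q i x) =
        ?e * (\<Prod>i\<in>V. (x i / q i x) powr (a i - 1) * (1 / q i x))"
      by (simp only: prod.distrib mult_ac)
    also have "(\<Prod>i\<in>V. (x i / q i x) powr (a i - 1) * (1 / q i x)) =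
        (\<Prod>i\<in>V. x i powr (a i - 1) * q i x powr - a i)"
    proof (rule prod.cong[OF refl])
      fix i assume "i \<in> V"
      have "q i x powr a i = q i x powr (a i - 1) * q i x"
        using powr_add[of "q i x" "a i - 1" 1] qpos[of i] by simp
      then show "(x i / q i x) powr (a i - 1) * (1 / q i x) = x i powr (a i - 1) * q i x powr - a i"
        using qpos[of i] pos[OF \<open>i \<in> V\<close>]
        by (simp add: powr_divide powr_minus_divide)
    qed
    also have "\<dots> = (\<Prod>i\<in>V. x i powr (a i - 1)) * (\<Prod>i\<in>V. q i x powr - a i)"
      by (rule prod.distrib)
    also have "(\<Prod>i\<in>V. q i x powr - a i) = (\<Prod>i\<in>V. if i = r then 1 else
        let p = parent V E r i in (1 + C p i / C p p * x i) powr - a p)"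
      unfolding q_def by (rule prod_child_factor_powr[OF T r C pos])
    also have "?e = (\<Prod>i\<in>V. exp (- C i i * x i))"
      using V by (simp add: exp_sum flip: sum_negf)
    finally have "tree_Kummer_kernel V E a C ?\<Psi> * (\<Prod>i\<in>V. 1 / q i x) =
        (\<Prod>i\<in>V. x i powr (a i - 1) * exp (- C i i * x i) * (if i = r then 1 else
        let p = parent V E r i in (1 + C p i / C p p * x i) powr - a p))"
      by (simp only: prod.distrib mult_ac)
    also have "\<dots> = (\<Prod>i\<in>V. factor_density V E a C r i (x i))"
      unfolding factor_density_def using pos by (intro prod.cong refl) simp
    finally show ?thesis .
  next
    case False
    then obtain i where i: "i \<in> V" "\<not> 0 < x i" by blast
    \<comment> \<open>Dividing by the positive \<open>q i x\<close> preserves signs, so both sides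
      vanish off the positive orthant.\<close>
    with qpos[of i] have "\<not> 0 < ?\<Psi> i" by (simp add: zero_less_divide_iff)
    with i have "?\<Psi> \<notin> {x. \<forall>i\<in>V. 0 < x i}" by blast
    then have "tree_Kummer_kernel V E a C ?\<Psi> = 0" by (simp add: tree_Kummer_kernel_def)
    moreover have "(\<Prod>i\<in>V. factor_density V E a C r i (x i)) = 0"
      using V i by (intro prod_zero bexI[of _ i]) (simp_all add: factor_density_def)
    ultimately show ?thesis by simp
  qed
qed

lemma distributed_tree_Phi:
  assumes T: "tree_graph V E" and r: "r \<in> V" and C: "C \<in> weight_matrices V E"
    and S: "tree_Kummer_distributed M S V E a C"
  shows "\<exists>K>0. distributed M (PiM V (\<lambda>_. lborel)) (\<lambda>\<omega>. tree_Phi V E C r (S \<omega>))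
    (\<lambda>x. ennreal K * (\<Prod>i\<in>V. ennreal (factor_density V E a C r i (x i))))"
proof -
  have V: "finite V" using T by (simp add: tree_graph_def)
  let ?q = "child_factor V E C r"
  let ?\<Psi> = "\<lambda>x i. if i \<in> V then x i / ?q i x else x i"
  from S obtain K where K: "0 < K"
    and D: "distributed M (PiM V (\<lambda>_. lborel)) S (\<lambda>x. ennreal (K * tree_Kummer_kernel V E a C x))"
    by (auto simp: tree_Kummer_distributed_def has_density_prop_to_def)
  note qpos = child_factor_pos[OF T C]
  have "distributed M (PiM V (\<lambda>_. lborel)) (\<lambda>\<omega>. tree_Phi V E C r (S \<omega>))
      (\<lambda>x. ennreal (K * tree_Kummer_kernel V E a C (?\<Psi> x)) * (\<Prod>i\<in>V. ennreal (1 / ?q i x)))"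
  proof (rule distributed_triangular[where d = "graph_dist V E r", OF V _ qpos _ D measurable_tree_Phi[OF V]])
    show "?q i \<in> borel_measurable (PiM V (\<lambda>_. lborel))" if "i \<in> V" for i
      unfolding child_factor_def
      by (intro borel_measurable_prod borel_measurable_add borel_measurable_times borel_measurable_max
          borel_measurable_const measurable_PiM_lborel_component) (simp add: children_def)
    show "?q i x = ?q i y" if "\<And>j. j \<in> V \<Longrightarrow> graph_dist V E r i < graph_dist V E r j \<Longrightarrow> x j = y j" for i x y
      unfolding child_factor_def using that by (intro prod.cong) (auto simp: children_def)
    fix x assume x: "x \<in> space (PiM V (\<lambda>_. lborel :: real measure))"
      and nz: "ennreal (K * tree_Kummer_kernel V E a C (?\<Psi> x)) \<noteq> 0"
    have pos: "0 < x i" if "i \<in> V" for i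
    proof -
      from nz have "tree_Kummer_kernel V E a C (?\<Psi> x) \<noteq> 0" by auto
      then have "\<forall>i\<in>V. 0 < ?\<Psi> x i"
        by (auto simp: tree_Kummer_kernel_def indicator_def split: if_splits)
      with that have "0 < x i / ?q i x" by force
      with qpos[of r i x] show ?thesis by (simp add: zero_less_divide_iff)
    qed
    show "tree_Phi V E C r (?\<Psi> x) = x"
    proof
      fix i
      show "tree_Phi V E C r (?\<Psi> x) i = x i"
      proof (cases "i \<in> V")
        case True
        then show ?thesis by (intro tree_Phi_left_inverse[OF T C pos])
      next
        case False
        \<comment> \<open>Outside \<open>V\<close> both sides are \<open>undefined\<close>, because
          \<open>x\<close> is extensional.\<close>
        with x show ?thesis by (auto simp: tree_Phi.simps space_PiM PiE_def extensional_def)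
      qed
    qed
  qed
  moreover have "ennreal (K * tree_Kummer_kernel V E a C (?\<Psi> x)) * (\<Prod>i\<in>V. ennreal (1 / ?q i x)) =
      ennreal K * (\<Prod>i\<in>V. ennreal (factor_density V E a C r i (x i)))" for x
  proof -
    have "(\<Prod>i\<in>V. ennreal (1 / ?q i x)) = ennreal (\<Prod>i\<in>V. 1 / ?q i x)"
      using qpos[of r _ x] by (intro prod_ennreal) (simp add: less_imp_le)
    moreover have "(\<Prod>i\<in>V. ennreal (factor_density V E a C r i (x i))) =
        ennreal (\<Prod>i\<in>V. factor_density V E a C r i (x i))"
      by (intro prod_ennreal) (auto simp: factor_density_def Let_def)
    moreover have "0 \<le> (\<Prod>i\<in>V. 1 / ?q i x)"
      using qpos[of r _ x] by (intro prod_nonneg) (simp add: less_imp_le)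
    ultimately show ?thesis
      using tree_Kummer_kernel_factor[OF T r C, of a x, symmetric] K
      by (simp add: mult.assoc flip: ennreal_mult' ennreal_mult'')
  qed
  ultimately show ?thesis using K by auto
qed

section \<open>Independence and the marginal laws\<close>

theorem theorem2:
  fixes V :: "'v set" and E :: "'v set set"
    and a :: "'v \<Rightarrow> real" and C :: "'v \<Rightarrow> 'v \<Rightarrow> real"
    and M :: "'w measure" and S :: "'w \<Rightarrow> 'v \<Rightarrow> real" and r :: 'v
  assumes "tree_graph V E" and "card V \<ge> 2"
    and "\<forall>i\<in>V. 0 < a i" and "C \<in> weight_matrices V E"
    and "prob_space M" and "tree_Kummer_distributed M S V E a C"
    and "r \<in> V"
  shows "prob_space.indep_vars M (\<lambda>_. borel) (\<lambda>i \<omega>. tree_Phi V E C r (S \<omega>) i) V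
    \<and> Gamma_distributed M (\<lambda>\<omega>. tree_Phi V E C r (S \<omega>) r) (a r) (C r r)
    \<and> (\<forall>i \<in> V - {r}. let p = parent V E r i in
         Kummer_distributed M (\<lambda>\<omega>. C p i / C p p * tree_Phi V E C r (S \<omega>) i)
           (a i) (a p - a i) (C p p * C i i / C p i))"
proof -
  note T = assms(1) and C = assms(4) and r = assms(7)
  interpret prob_space M by (rule assms(5))
  let ?X = "\<lambda>\<omega>. tree_Phi V E C r (S \<omega>)" and ?h = "factor_density V E a C r"
  have V: "finite V" "V \<noteq> {}" using T r by (auto simp: tree_graph_def)
  obtain K where D: "distributed M (PiM V (\<lambda>_. lborel)) ?X
      (\<lambda>x. ennreal K * (\<Prod>i\<in>V. ennreal (?h i (x i))))"
    using distributed_tree_Phi[OF T r C assms(6)] by blast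
  have h: "(\<lambda>t. ennreal (?h i t)) \<in> borel_measurable borel" for i
    unfolding factor_density_def by (cases "i = r") (simp_all add: Let_def)
  note indep = product_density_indep(1)[OF V h D] and marginal = product_density_indep(2)[OF V h D]
  have "Gamma_distributed M (\<lambda>\<omega>. ?X \<omega> r) (a r) (C r r)"
  proof -
    obtain k where k: "0 < k" "distributed M lborel (\<lambda>\<omega>. ?X \<omega> r) (\<lambda>x. ennreal k * ennreal (?h r x))"
      using marginal[OF r] by blast
    have "ennreal k * ennreal (?h r x) =
        ennreal (k * (x powr (a r - 1) * exp (- C r r * x) * indicator {0<..} x))" for x
      using k(1) by (simp add: factor_density_def flip: ennreal_mult')
    with k show ?thesis
      unfolding Gamma_distributed_def has_density_prop_to_def by auto
  qed
  moreover have "Kummer_distributed M (\<lambda>\<omega>. C p i / C p p * ?X \<omega> i)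
      (a i) (a p - a i) (C p p * C i i / C p i)" if i: "i \<in> V - {r}" and p: "p = parent V E r i" for i p
  proof -
    have "p \<in> V" "{p, i} \<in> E"
      using child_of_parent[OF T r, of i] i p by (auto simp: children_def)
    with C i have Cpos: "0 < C p i" "0 < C p p" by (auto simp: weight_matrices_def)
    define c where "c = C p i / C p p"
    have c: "0 < c" using Cpos by (simp add: c_def)
    obtain k where k: "0 < k" "distributed M lborel (\<lambda>\<omega>. ?X \<omega> i) (\<lambda>x. ennreal k * ennreal (?h i x))"
      using marginal[of i] i by blast
    \<comment> \<open>Scaling by \<open>c\<close> turns the parent factor into \<open>1 + x\<close>
      and the rate \<open>C i i\<close> into \<open>C i i / c\<close>, the required third Kummer
      parameter.\<close>
    have "distributed M lborel (\<lambda>\<omega>. 0 + c * ?X \<omega> i)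
        (\<lambda>x. ennreal k * ennreal (?h i ((x - 0) / c)) / ennreal \<bar>c\<bar>)"
      using c by (intro distributed_affine[OF k(2)]) simp
    \<comment> \<open>In the new constant, \<open>c powr (a i - 1)\<close> comes from the power of
      \<open>x / c\<close> and the other \<open>c\<close> from the scaling of the density. The
      exponent \<open>a i + (a p - a i)\<close> is just \<open>a p\<close>.\<close>
    moreover have "ennreal k * ennreal (?h i ((x - 0) / c)) / ennreal \<bar>c\<bar> =
        ennreal (k / (c powr (a i - 1) * c) * (x powr (a i - 1) / (1 + x) powr (a i + (a p - a i)) *
          exp (- (C p p * C i i / C p i) * x) * indicator {0<..} x))" for x
    proof -
      have "?h i (x / c) / c = 1 / (c powr (a i - 1) * c) * (x powr (a i - 1) /
          (1 + x) powr (a i + (a p - a i)) * exp (- (C p p * C i i / C p i) * x) * indicator {0<..} x)"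
      proof (cases "0 < x")
        case True
        have "C p i / C p p * (x / c) = x" unfolding c_def[symmetric] using c by simp
        with True have "?h i (x / c) = (x / c) powr (a i - 1) * exp (- C i i * (x / c)) * (1 + x) powr - a p"
          using i c by (simp add: factor_density_def Let_def p[symmetric]
              del: times_divide_eq_right times_divide_eq_left times_divide_times_eq)
        moreover have "- C i i * (x / c) = - (C p p * C i i / C p i) * x"
          using Cpos by (simp add: c_def field_simps)
        ultimately have "?h i (x / c) = (x / c) powr (a i - 1) *
            exp (- (C p p * C i i / C p i) * x) * (1 + x) powr - a p" by (simp only:)
        then show ?thesis
          using True c by (simp add: powr_divide powr_minus_divide)
      qed (use c in \<open>simp add: factor_density_def zero_less_divide_iff\<close>)
      moreover have "0 \<le> ?h i (x / c)" by (auto simp: factor_density_def Let_def)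
      ultimately show ?thesis
        using k(1) c by (simp add: divide_ennreal flip: ennreal_mult' times_divide_eq_right)
    qed
    ultimately have "distributed M lborel (\<lambda>\<omega>. c * ?X \<omega> i) (\<lambda>x. ennreal (k / (c powr (a i - 1) * c) *
        (x powr (a i - 1) / (1 + x) powr (a i + (a p - a i)) *
          exp (- (C p p * C i i / C p i) * x) * indicator {0<..} x)))"
      by (simp only: add_0)
    then show ?thesis
      unfolding Kummer_distributed_def has_density_prop_to_def c_def[symmetric]
      using k(1) c by (intro exI[of _ "k / (c powr (a i - 1) * c)"]) simp
  qed
  ultimately show ?thesis using indep by (simp add: Let_def)
qed

end
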